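(* Let $\Omega\subset\mathbb{R}^n$ and $J_\varepsilon$ be as in the general setting described in the context. Let $\mathcal{L}_\varepsilon: L^2(\Omega)\to L^2(\Omega)$ be given by $$\mathcal{L}_\varepsilon u(x)=\int_\Omega J_\varepsilon(x-y)u(y)\,dy+b_\varepsilon(x)u(x),\qquad b_\varepsilon(x)=-\int_\Omega J_\varepsilon(x-y)\,dy .$$ Then the spectrum of $\mathcal{L}_\varepsilon$ is given by $$\sigma(\mathcal{L}_\varepsilon)=b_\varepsilon\left[\,\overline{\Omega}\,\right]\cup\{\beta_k\}_{k=0}^\infty,$$ where $$b_\varepsilon\left[\,\overline{\Omega}\,\right]=\left\{-\int_\Omega J_\varepsilon(x-y)\,dy \;:\; x\in\overline{\Omega}\right\}$$ and the sequence $\{\beta_k\}_{k=0}^\infty$ is a set of isolated eigenvalues of $\mathcal{L}_\varepsilon$.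
   Context: General setting: $\Omega\subset\mathbb{R}^n$ is open and bounded. The kernel $J\in C(\mathbb{R}^n)$ satisfies: $J(z)\ge 0$ for all $z\in\mathbb{R}^n$ and $J(0)>0$; $J(z)=J(-z)$ for all $z$; $J(z)\to 0$ as $|z|\to\infty$; $\int_{\mathbb{R}^n}J(z)|z|^2\,dz<\infty$; $\int_{\mathbb{R}^n}J(z)\,dz=1$. For $\varepsilon>0$ and $m\in[0,2]$ the re-scaled kernel $J_\varepsilon\in C(\mathbb{R}^n)$ is $$J_\varepsilon(z)=\frac{C_{norm}}{\varepsilon^{m+n}}J\left(\frac{z}{\varepsilon}\right),\qquad C_{norm}=\left(\frac12\int_{\mathbb{R}^n}J(z)|z|^2\,dz\right)^{-1}.$$ *)

theory Defs
  imports "HOL-Analysis.Analysis"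
begin

section \<open>The Hilbert space of square integrable functions\<close>

text \<open>
  The library has no \<open>L\<^sup>2\<close> space. It is built here over complex scalars (so that spectra are
  subsets of the complex plane) as the set of classes of square integrable functions modulo
  equality almost everywhere.
\<close>

definition square_integrable :: "'a measure \<Rightarrow> ('a \<Rightarrow> complex) set" where
  "square_integrable M = {u \<in> borel_measurable M. integrable M (\<lambda>x. (cmod (u x))\<^sup>2)}"

definition L2_rel :: "'a measure \<Rightarrow> (('a \<Rightarrow> complex) \<times> ('a \<Rightarrow> complex)) set" where
  "L2_rel M = {(u, v). u \<in> square_integrable M \<and> v \<in> square_integrable M \<and> (AE x in M. u x = v x)}"

definition L2 :: "'a measure \<Rightarrow> ('a \<Rightarrow> complex) set set" where
  "L2 M = square_integrable M // L2_rel M"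

definition L2_class :: "'a measure \<Rightarrow> ('a \<Rightarrow> complex) \<Rightarrow> ('a \<Rightarrow> complex) set" where
  "L2_class M u = L2_rel M `` {u}"

definition L2_zero :: "'a measure \<Rightarrow> ('a \<Rightarrow> complex) set" where
  "L2_zero M = L2_class M (\<lambda>x. 0)"

text \<open>Lifting of a map on functions that respects equality almost everywhere.\<close>

definition L2_lift ::
  "'a measure \<Rightarrow> (('a \<Rightarrow> complex) \<Rightarrow> ('a \<Rightarrow> complex)) \<Rightarrow> ('a \<Rightarrow> complex) set \<Rightarrow> ('a \<Rightarrow> complex) set" where
  "L2_lift M F U = (\<Union>u\<in>U. L2_class M (F u))"

definition L2_scale :: "'a measure \<Rightarrow> complex \<Rightarrow> ('a \<Rightarrow> complex) set \<Rightarrow> ('a \<Rightarrow> complex) set" where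
  "L2_scale M c = L2_lift M (\<lambda>u x. c * u x)"

definition L2_minus ::
  "'a measure \<Rightarrow> ('a \<Rightarrow> complex) set \<Rightarrow> ('a \<Rightarrow> complex) set \<Rightarrow> ('a \<Rightarrow> complex) set" where
  "L2_minus M U V = (\<Union>u\<in>U. \<Union>v\<in>V. L2_class M (\<lambda>x. u x - v x))"

definition L2_norm :: "'a measure \<Rightarrow> ('a \<Rightarrow> complex) set \<Rightarrow> real" where
  "L2_norm M U = the_elem ((\<lambda>u. sqrt (LINT x|M. (cmod (u x))\<^sup>2)) ` U)"


section \<open>Spectrum and eigenvalues of a bounded linear operator\<close>

text \<open>
  For a linear operator \<open>T\<close> on \<open>L2 M\<close>: \<open>c\<close> lies in the spectrum iff \<open>T - c I\<close> has no bounded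
  inverse defined on all of \<open>L2 M\<close>. The inequality states that the inverse has norm at most \<open>C\<close>.
\<close>

definition L2_spectrum ::
  "'a measure \<Rightarrow> (('a \<Rightarrow> complex) set \<Rightarrow> ('a \<Rightarrow> complex) set) \<Rightarrow> complex set" where
  "L2_spectrum M T = {c. \<not> (bij_betw (\<lambda>U. L2_minus M (T U) (L2_scale M c U)) (L2 M) (L2 M) \<and>
      (\<exists>C. \<forall>U\<in>L2 M. L2_norm M U \<le> C * L2_norm M (L2_minus M (T U) (L2_scale M c U))))}"

definition L2_eigenvalue ::
  "'a measure \<Rightarrow> (('a \<Rightarrow> complex) set \<Rightarrow> ('a \<Rightarrow> complex) set) \<Rightarrow> complex \<Rightarrow> bool" where
  "L2_eigenvalue M T c \<longleftrightarrow> (\<exists>U\<in>L2 M. U \<noteq> L2_zero M \<and> T U = L2_scale M c U)"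

definition L2_isolated_eigenvalue ::
  "'a measure \<Rightarrow> (('a \<Rightarrow> complex) set \<Rightarrow> ('a \<Rightarrow> complex) set) \<Rightarrow> complex \<Rightarrow> bool" where
  "L2_isolated_eigenvalue M T c \<longleftrightarrow> L2_eigenvalue M T c \<and> c isolated_in L2_spectrum M T"


section \<open>The nonlocal operator\<close>

definition C_norm :: "(real ^ 'n \<Rightarrow> real) \<Rightarrow> real" where
  "C_norm J = inverse (1 / 2 * (LINT z|lebesgue. J z * (norm z)\<^sup>2))"

definition J_eps :: "(real ^ 'n \<Rightarrow> real) \<Rightarrow> real \<Rightarrow> real \<Rightarrow> real ^ 'n \<Rightarrow> real" where
  "J_eps J m \<epsilon> z = C_norm J / \<epsilon> powr (m + real CARD('n)) * J (z /\<^sub>R \<epsilon>)"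

definition b_eps :: "(real ^ 'n) set \<Rightarrow> (real ^ 'n \<Rightarrow> real) \<Rightarrow> real \<Rightarrow> real \<Rightarrow> real ^ 'n \<Rightarrow> real" where
  "b_eps \<Omega> J m \<epsilon> x = - (LINT y|lebesgue_on \<Omega>. J_eps J m \<epsilon> (x - y))"

definition nonlocal_fun :: "(real ^ 'n) set \<Rightarrow> (real ^ 'n \<Rightarrow> real) \<Rightarrow> real \<Rightarrow> real \<Rightarrow>
    (real ^ 'n \<Rightarrow> complex) \<Rightarrow> (real ^ 'n \<Rightarrow> complex)" where
  "nonlocal_fun \<Omega> J m \<epsilon> u x =
     (LINT y|lebesgue_on \<Omega>. complex_of_real (J_eps J m \<epsilon> (x - y)) * u y)
       + complex_of_real (b_eps \<Omega> J m \<epsilon> x) * u x"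

definition L_eps :: "(real ^ 'n) set \<Rightarrow> (real ^ 'n \<Rightarrow> real) \<Rightarrow> real \<Rightarrow> real \<Rightarrow>
    (real ^ 'n \<Rightarrow> complex) set \<Rightarrow> (real ^ 'n \<Rightarrow> complex) set" where
  "L_eps \<Omega> J m \<epsilon> = L2_lift (lebesgue_on \<Omega>) (nonlocal_fun \<Omega> J m \<epsilon>)"


section \<open>The operations on classes are well defined\<close>

lemma equiv_L2_rel: "equiv (square_integrable M) (L2_rel M)"
proof (rule equivI)
  show "trans (L2_rel M)"
  proof (rule transI)
    fix u v w assume uv: "(u, v) \<in> L2_rel M" and vw: "(v, w) \<in> L2_rel M"
    then have "AE x in M. u x = v x" "AE x in M. v x = w x" by (auto simp: L2_rel_def)
    then have "AE x in M. u x = w x" by eventually_elim simp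
    with uv vw show "(u, w) \<in> L2_rel M" by (simp add: L2_rel_def)
  qed
next
  show "sym (L2_rel M)"
    by (rule symI) (simp add: L2_rel_def eq_commute)
qed (auto simp: L2_rel_def refl_on_def)

lemma L2_class_in: "u \<in> square_integrable M \<Longrightarrow> L2_class M u \<in> L2 M"
  by (simp add: L2_class_def L2_def quotientI)

lemma in_L2_class_iff:
  "v \<in> L2_class M u \<longleftrightarrow> u \<in> square_integrable M \<and> v \<in> square_integrable M \<and> (AE x in M. u x = v x)"
  by (auto simp: L2_class_def L2_rel_def)

lemma L2_class_eq_iff:
  assumes "u \<in> square_integrable M" "v \<in> square_integrable M"
  shows "L2_class M u = L2_class M v \<longleftrightarrow> (AE x in M. u x = v x)"
  using eq_equiv_class_iff[OF equiv_L2_rel assms] assms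
  by (simp add: L2_class_def L2_rel_def)

lemma L2_cases:
  assumes "U \<in> L2 M"
  obtains u where "u \<in> square_integrable M" "U = L2_class M u"
  using assms that unfolding L2_def L2_class_def by (elim quotientE) blast

lemma square_integrable_scale:
  "u \<in> square_integrable M \<Longrightarrow> (\<lambda>x. c * u x) \<in> square_integrable M"
  by (auto simp: square_integrable_def norm_mult power_mult_distrib)

lemma square_integrable_minus:
  assumes "u \<in> square_integrable M" "v \<in> square_integrable M"
  shows "(\<lambda>x. u x - v x) \<in> square_integrable M"
proof -
  have [measurable]: "u \<in> borel_measurable M" "v \<in> borel_measurable M"
    using assms by (auto simp: square_integrable_def)
  have "integrable M (\<lambda>x. (cmod (u x - v x))\<^sup>2)"
  proof (rule Bochner_Integration.integrable_bound)
    show "integrable M (\<lambda>x. 2 * (cmod (u x))\<^sup>2 + 2 * (cmod (v x))\<^sup>2)"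
      using assms by (auto simp: square_integrable_def)
    have "(cmod (a - b))\<^sup>2 \<le> 2 * (cmod a)\<^sup>2 + 2 * (cmod b)\<^sup>2" for a b
    proof -
      have "(cmod (a - b))\<^sup>2 \<le> (cmod a + cmod b)\<^sup>2"
        by (intro power_mono norm_triangle_ineq4) auto
      also have "\<dots> \<le> 2 * (cmod a)\<^sup>2 + 2 * (cmod b)\<^sup>2"
        using sum_squares_bound[of "cmod a" "cmod b"] by (simp add: power2_sum)
      finally show ?thesis .
    qed
    then show "AE x in M. norm ((cmod (u x - v x))\<^sup>2) \<le> norm (2 * (cmod (u x))\<^sup>2 + 2 * (cmod (v x))\<^sup>2)"
      by simp
  qed measurable
  then show ?thesis by (simp add: square_integrable_def)
qed

lemma L2_lift_class:
  assumes "u \<in> square_integrable M" "F u \<in> square_integrable M"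
    and "\<And>v. v \<in> L2_class M u \<Longrightarrow> F v \<in> L2_class M (F u)"
  shows "L2_lift M F (L2_class M u) = L2_class M (F u)"
proof -
  have "L2_class M (F v) = L2_class M (F u)" if "v \<in> L2_class M u" for v
  proof -
    have v: "F v \<in> square_integrable M" "AE x in M. F u x = F v x"
      using assms(3)[OF that] by (simp_all add: in_L2_class_iff)
    then show ?thesis
      using L2_class_eq_iff[OF assms(2) v(1)] by simp
  qed
  then have "L2_lift M F (L2_class M u) = (\<Union>v\<in>L2_class M u. L2_class M (F u))"
    unfolding L2_lift_def by (rule SUP_cong[OF refl])
  moreover have "u \<in> L2_class M u" using assms(1) by (simp add: in_L2_class_iff)
  ultimately show ?thesis by auto
qed

lemma L2_scale_class:
  assumes "u \<in> square_integrable M"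
  shows "L2_scale M c (L2_class M u) = L2_class M (\<lambda>x. c * u x)"
  unfolding L2_scale_def
proof (rule L2_lift_class)
  fix v assume v: "v \<in> L2_class M u"
  then have "AE x in M. u x = v x" by (simp add: in_L2_class_iff)
  then have "AE x in M. c * u x = c * v x" by eventually_elim simp
  with v show "(\<lambda>x. c * v x) \<in> L2_class M (\<lambda>x. c * u x)"
    by (simp add: in_L2_class_iff square_integrable_scale)
qed (use assms in \<open>auto intro: square_integrable_scale\<close>)

lemma L2_minus_class:
  assumes "u \<in> square_integrable M" "v \<in> square_integrable M"
  shows "L2_minus M (L2_class M u) (L2_class M v) = L2_class M (\<lambda>x. u x - v x)"
proof -
  have "L2_class M (\<lambda>x. u' x - v' x) = L2_class M (\<lambda>x. u x - v x)"
    if "u' \<in> L2_class M u" "v' \<in> L2_class M v" for u' v'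
  proof (rule iffD2[OF L2_class_eq_iff])
    have "AE x in M. u x = u' x" "AE x in M. v x = v' x"
      using that by (auto simp: in_L2_class_iff)
    then show "AE x in M. u' x - v' x = u x - v x" by eventually_elim auto
  qed (use that in \<open>auto simp: in_L2_class_iff intro!: square_integrable_minus\<close>)
  then have "L2_minus M (L2_class M u) (L2_class M v) =
      (\<Union>u'\<in>L2_class M u. \<Union>v'\<in>L2_class M v. L2_class M (\<lambda>x. u x - v x))"
    unfolding L2_minus_def by (intro SUP_cong refl)
  moreover have "u \<in> L2_class M u" "v \<in> L2_class M v" using assms by (simp_all add: in_L2_class_iff)
  ultimately show ?thesis by auto
qed

lemma L2_norm_class:
  assumes "u \<in> square_integrable M"
  shows "L2_norm M (L2_class M u) = sqrt (LINT x|M. (cmod (u x))\<^sup>2)"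
proof -
  have "(LINT x|M. (cmod (v x))\<^sup>2) = (LINT x|M. (cmod (u x))\<^sup>2)" if "v \<in> L2_class M u" for v
  proof (rule integral_cong_AE)
    have "AE x in M. u x = v x" using that by (auto simp: in_L2_class_iff)
    then show "AE x in M. (cmod (v x))\<^sup>2 = (cmod (u x))\<^sup>2" by eventually_elim auto
  qed (use that in \<open>auto simp: in_L2_class_iff square_integrable_def\<close>)
  then have "(\<lambda>v. sqrt (LINT x|M. (cmod (v x))\<^sup>2)) ` L2_class M u =
      (\<lambda>v. sqrt (LINT x|M. (cmod (u x))\<^sup>2)) ` L2_class M u"
    by (intro image_cong refl arg_cong[where f = sqrt])
  moreover have "L2_class M u \<noteq> {}"
    using assms in_L2_class_iff[of u M u] by force
  ultimately show ?thesis by (simp add: L2_norm_def image_constant_conv)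
qed

end

theory Submission
  imports Defs "HOL-Complex_Analysis.Great_Picard"
begin

text \<open>
  The operator has the form \<open>u \<mapsto> K u + b u\<close>, where \<open>K\<close> is an integral operator with a continuous
  symmetric real kernel on a bounded open set and \<open>b\<close> is a continuous real function. The spectrum of
  such an operator is computed for arbitrary \<open>k\<close> and \<open>b\<close>.

  If \<open>c = b x\<close> for some \<open>x\<close> in the closure of \<open>\<Omega>\<close>, then indicator functions of small balls near \<open>x\<close>
  are approximate eigenfunctions: \<open>b - c\<close> is small on the ball, and the smoothing operator \<open>K\<close> maps
  functions of small \<open>L\<^sup>1\<close> norm to uniformly small functions (\<open>multiplier_range_in_spectrum\<close>).

  If \<open>c\<close> is not a value of \<open>b\<close> on the closure, then \<open>b - c\<close> is bounded away from zero, and with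
  \<open>w = K u\<close> the equation \<open>K u + (b - c) u = f\<close> is equivalent to
  \<open>w + K (w / (b - c)) = K (f / (b - c))\<close>. This is an equation in a space of bounded continuous
  functions, in which \<open>K\<close> is compact by the theorem of Arzela and Ascoli. The Fredholm alternative
  (\<open>fredholm_alternative\<close>) solves it unless \<open>c\<close> is an eigenvalue, so outside the range of \<open>b\<close> the
  spectrum consists of eigenvalues (\<open>not_spectrum_if_not_eigenvalue\<close>). Passing to continuous functions
  makes the completeness of \<open>L\<^sup>2\<close> unnecessary.

  By symmetry of \<open>k\<close>, normalized eigenfunctions of distinct eigenvalues are at distance \<open>sqrt 2\<close> in
  \<open>L\<^sup>2\<close>. If eigenvalues \<open>c\<^sub>n\<close> accumulated at a point \<open>c\<close> outside the range of \<open>b\<close>, compactness would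
  make a subsequence of the eigenfunctions \<open>u\<^sub>n = K u\<^sub>n / (c\<^sub>n - b)\<close> uniformly convergent, a
  contradiction (\<open>eigenvalues_isolated\<close>). Hence these eigenvalues are isolated and form a countable
  set. It is nonempty for the nonlocal operator, because constants are eigenfunctions for the
  eigenvalue \<open>0\<close> and \<open>b\<close> is negative on the closure of \<open>\<Omega>\<close>.
\<close>

section \<open>The Fredholm alternative\<close>

text \<open>
  Compactness of a map between normed spaces, in sequential form: images of bounded sequences have
  convergent subsequences. No linearity is built in.
\<close>

definition compact_map :: "('a::real_normed_vector \<Rightarrow> 'b::real_normed_vector) \<Rightarrow> bool" where
  "compact_map C \<longleftrightarrow> (\<forall>x :: nat \<Rightarrow> 'a. bounded (range x) \<longrightarrow>
     (\<exists>r l. strict_mono r \<and> (\<lambda>n. C (x (r n))) \<longlonglongrightarrow> l))"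

lemma compact_mapE:
  assumes "compact_map C" and "\<And>n. norm (x n) \<le> B"
  obtains r l where "strict_mono (r :: nat \<Rightarrow> nat)" "(\<lambda>n. C (x (r n))) \<longlonglongrightarrow> l"
proof -
  have "bounded (range x)"
    using assms(2) by (auto simp: bounded_iff)
  then show ?thesis using assms(1) that unfolding compact_map_def by blast
qed

text \<open>
  Otherwise there are unit vectors \<open>u\<^sub>n\<close> with \<open>u\<^sub>n - C u\<^sub>n\<close> tending to zero; by compactness a subsequence
  converges to a unit vector fixed by \<open>C\<close>.
\<close>

lemma compact_perturbation_bounded_below:
  fixes C :: "'a::real_normed_vector \<Rightarrow> 'a"
  assumes C: "bounded_linear C" "compact_map C"
    and inj: "\<And>x. x = C x \<Longrightarrow> x = 0"
  obtains a where "a > 0" "\<And>x. a * norm x \<le> norm (x - C x)"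
proof -
  interpret C: bounded_linear C by fact
  have "\<exists>a>0. \<forall>x. a * norm x \<le> norm (x - C x)"
  proof (rule ccontr)
    assume "\<not> ?thesis"
    then have "\<exists>x. norm (x - C x) < inverse (real (Suc n)) * norm x" for n
      by (metis inverse_positive_iff_positive not_le of_nat_0_less_iff zero_less_Suc)
    then obtain x where x: "\<And>n. norm (x n - C (x n)) < inverse (real (Suc n)) * norm (x n)"
      by metis
    define u where "u n = x n /\<^sub>R norm (x n)" for n
    have nz: "x n \<noteq> 0" for n using x[of n] by auto
    have nu: "norm (u n) = 1" for n using nz[of n] by (simp add: u_def)
    have "norm (u n - C (u n)) \<le> inverse (real (Suc n))" for n
    proof -
      have "norm (u n - C (u n)) = norm (x n - C (x n)) / norm (x n)"
        by (simp add: u_def C.scaleR flip: scaleR_diff_right)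
           (simp add: divide_inverse mult.commute)
      then show ?thesis
        using less_imp_le[OF x[of n]] nz[of n] by (simp only: pos_divide_le_eq zero_less_norm_iff simp_thms)
    qed
    then have S0: "(\<lambda>n. u n - C (u n)) \<longlonglongrightarrow> 0"
      by (intro Lim_null_comparison[OF always_eventually LIMSEQ_inverse_real_of_nat] allI)
    obtain r l where r: "strict_mono r" and l: "(\<lambda>n. C (u (r n))) \<longlonglongrightarrow> l"
      by (rule compact_mapE[OF C(2), of u 1]) (simp_all add: nu)
    have "(\<lambda>n. u (r n) - C (u (r n))) \<longlonglongrightarrow> 0"
      using LIMSEQ_subseq_LIMSEQ[OF S0 r] by (simp add: o_def)
    from tendsto_add[OF this l] have ul: "(\<lambda>n. u (r n)) \<longlonglongrightarrow> l" by simp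
    from C.tendsto[OF this] l have "l = C l" using LIMSEQ_unique by blast
    with inj have "l = 0" by blast
    moreover have "norm l = 1"
      using tendsto_norm[OF ul] by (simp add: nu LIMSEQ_const_iff)
    ultimately show False by simp
  qed
  then show ?thesis using that by blast
qed

text \<open>
  The lemma of Riesz on almost orthogonal vectors; \<open>1 / 2\<close> stands for any constant below \<open>1\<close>.
\<close>

lemma riesz_almost_orthogonal:
  fixes V :: "'a::real_normed_vector set"
  assumes "subspace V" "closed V" "subspace W" "V \<subseteq> W" "z \<in> W" "z \<notin> V"
  obtains x where "x \<in> W" "norm x = 1" "\<And>y. y \<in> V \<Longrightarrow> 1 / 2 \<le> norm (x - y)"
proof -
  define d where "d = infdist z V"
  have ne: "V \<noteq> {}" using subspace_0[OF assms(1)] by auto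
  have d: "d > 0"
    using infdist_pos_not_in_closed[OF assms(2) ne assms(6)] by (simp add: d_def)
  have "\<exists>v\<in>V. dist z v < 2 * d"
    using d ne cInf_lessD[of "(dist z) ` V" "2 * d"]
    by (auto simp: d_def infdist_def)
  then obtain v where v: "v \<in> V" "dist z v < 2 * d" by blast
  define t where "t = norm (z - v)"
  have t: "t > 0" using assms(6) v(1) by (auto simp: t_def)
  show ?thesis
  proof (rule that[of "(z - v) /\<^sub>R t"])
    show "(z - v) /\<^sub>R t \<in> W" using assms v by (meson subset_iff subspace_diff subspace_scale)
    show "norm ((z - v) /\<^sub>R t) = 1" using t by (simp add: t_def)
    fix y assume "y \<in> V"
    then have "v + t *\<^sub>R y \<in> V" using assms(1) v(1) by (simp add: subspace_add subspace_scale)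
    then have "d \<le> norm (z - (v + t *\<^sub>R y))"
      unfolding d_def dist_norm[symmetric] by (rule infdist_le)
    also have "z - (v + t *\<^sub>R y) = t *\<^sub>R ((z - v) /\<^sub>R t - y)"
      using t by (simp add: algebra_simps)
    also have "norm \<dots> = t * norm ((z - v) /\<^sub>R t - y)" using t by simp
    finally have "t * (1 / 2) \<le> t * norm ((z - v) /\<^sub>R t - y)"
      using v(2) by (simp add: t_def dist_norm)
    then show "1 / 2 \<le> norm ((z - v) /\<^sub>R t - y)" using t by (rule mult_left_le_imp_le)
  qed
qed

lemma compact_perturbation_closed_image:
  fixes C :: "'a::real_normed_vector \<Rightarrow> 'a"
  assumes C: "bounded_linear C" "compact_map C"
    and a: "a > 0" "\<And>x. a * norm x \<le> norm (x - C x)"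
    and A: "closed A"
  shows "closed ((\<lambda>x. x - C x) ` A)"
  unfolding closed_sequential_limits
proof (intro allI impI, elim conjE)
  interpret C: bounded_linear C by fact
  fix y l assume "\<forall>n. y n \<in> (\<lambda>x. x - C x) ` A" and y: "y \<longlonglongrightarrow> l"
  then have "\<forall>n. \<exists>x. x \<in> A \<and> y n = x - C x" by blast
  from choice[OF this] obtain x where xA: "\<And>n. x n \<in> A" and yx: "\<And>n. y n = x n - C (x n)"
    by blast
  obtain B where B: "\<And>n. norm (y n) \<le> B"
    using convergent_imp_bounded[OF y] by (auto simp: bounded_iff)
  have "norm (x n) \<le> B / a" for n
    using a(2)[of "x n"] B[of n] a(1) by (simp add: yx field_simps)
  then obtain r z where r: "strict_mono r" and z: "(\<lambda>n. C (x (r n))) \<longlonglongrightarrow> z"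
    by (rule compact_mapE[OF C(2)])
  have "(\<lambda>n. y (r n)) \<longlonglongrightarrow> l" using LIMSEQ_subseq_LIMSEQ[OF y r] by (simp add: o_def)
  from tendsto_add[OF this z] have xl: "(\<lambda>n. x (r n)) \<longlonglongrightarrow> l + z" by (simp add: yx)
  have "l + z \<in> A" using closed_sequentially[OF A _ xl] xA by blast
  moreover have "l = (l + z) - C (l + z)"
    using LIMSEQ_unique[OF C.tendsto[OF xl] z] by simp
  ultimately show "l \<in> (\<lambda>x. x - C x) ` A" by blast
qed

text \<open>
  For \<open>S = I - C\<close> injective but not surjective, the ranges of the powers of \<open>S\<close> form a strictly
  decreasing sequence of closed subspaces. Almost orthogonal unit vectors \<open>x\<^sub>n\<close> chosen from them have
  images \<open>C x\<^sub>n\<close> at mutual distance at least \<open>1 / 2\<close>, against compactness. Completeness of the space is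
  not needed.
\<close>

theorem fredholm_alternative:
  fixes C :: "'a::real_normed_vector \<Rightarrow> 'a"
  assumes C: "bounded_linear C" "compact_map C"
    and inj: "\<And>x. x = C x \<Longrightarrow> x = 0"
  shows "surj (\<lambda>x. x - C x)"
proof (rule ccontr)
  interpret C: bounded_linear C by fact
  define S where "S x = x - C x" for x
  have S_lin: "linear S" unfolding S_def
    by (intro linear_compose_sub linear_ident C.linear)
  obtain a where a: "a > 0" "\<And>x. a * norm x \<le> norm (x - C x)"
    using compact_perturbation_bounded_below[OF assms] by blast
  have inj_S: "inj S"
    using inj by (auto simp: linear_injective_0[OF S_lin] S_def)
  define V where "V n = range (S ^^ n)" for n
  have V_Suc: "V (Suc n) = S ` V n" for n by (simp add: V_def image_comp)
  have V_closed: "closed (V n)" and V_sub: "subspace (V n)" for n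
  proof (induction n)
    case (Suc n)
    { case 1 show ?case using Suc compact_perturbation_closed_image[OF C a] unfolding V_Suc S_def by blast }
    { case 2 show ?case using Suc linear_subspace_image[OF S_lin] unfolding V_Suc by blast }
  qed (simp_all add: V_def)
  have V_dec1: "V (Suc n) \<subseteq> V n" for n
    unfolding V_def by (auto simp: funpow_swap1)
  have V_dec: "V n \<subseteq> V m" if "m \<le> n" for m n
    using V_dec1 that by (rule lift_Suc_antimono_le)
  assume "\<not> ?thesis"
  then obtain y where y: "y \<notin> range S" unfolding S_def by blast
  have notin: "(S ^^ n) y \<notin> V (Suc n)" for n
  proof
    assume "(S ^^ n) y \<in> V (Suc n)"
    then obtain x where "(S ^^ n) y = (S ^^ n) (S x)" by (auto simp: V_def funpow_swap1)
    moreover have "inj (S ^^ n)" using inj_S by (rule inj_fn)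
    ultimately show False using y by (metis injD rangeI)
  qed
  have "\<exists>x. x \<in> V n \<and> norm x = 1 \<and> (\<forall>y\<in>V (Suc n). 1 / 2 \<le> norm (x - y))" for n
    by (rule riesz_almost_orthogonal[OF V_sub V_closed V_sub V_dec1 _ notin[of n]])
      (auto simp: V_def)
  then have "\<forall>n. \<exists>x. x \<in> V n \<and> norm x = 1 \<and> (\<forall>y\<in>V (Suc n). 1 / 2 \<le> norm (x - y))" ..
  from choice[OF this] obtain x where xV: "\<And>n. x n \<in> V n" and nx: "\<And>n. norm (x n) = 1"
    and xd: "\<And>n y. y \<in> V (Suc n) \<Longrightarrow> 1 / 2 \<le> norm (x n - y)"
    by blast
  obtain r l where r: "strict_mono r" and l: "(\<lambda>n. C (x (r n))) \<longlonglongrightarrow> l"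
    by (rule compact_mapE[OF C(2), of x 1]) (simp_all add: nx)
  have sep: "1 / 2 \<le> norm (C (x n) - C (x m))" if "n < m" for n m
  proof -
    have "S (x n) \<in> V (Suc n)" "x m \<in> V (Suc n)" "S (x m) \<in> V (Suc n)"
      using xV[of n] xV[of m] V_dec[of "Suc n" m] V_dec[of "Suc n" "Suc m"] that
      by (auto simp: V_Suc)
    then have "S (x n) + x m - S (x m) \<in> V (Suc n)"
      using V_sub by (meson subspace_add subspace_diff)
    from xd[OF this] show ?thesis by (simp add: S_def algebra_simps)
  qed
  obtain N where "\<And>n m. n \<ge> N \<Longrightarrow> m \<ge> N \<Longrightarrow> dist (C (x (r n))) (C (x (r m))) < 1 / 2"
    using LIMSEQ_imp_Cauchy[OF l] unfolding Cauchy_def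
    by (metis half_gt_zero_iff zero_less_one)
  from this[of N "Suc N"] show False
    using sep[of "r N" "r (Suc N)"] strict_monoD[OF r, of N "Suc N"] by (simp add: dist_norm)
qed

section \<open>Spectrum and eigenvalues through representatives\<close>

text \<open>
  A map \<open>F\<close> on functions that induces an operator on \<open>L\<^sup>2\<close>: it preserves square integrability,
  respects equality almost everywhere and is additive. Homogeneity is not needed for
  the characterizations below.
\<close>

locale L2_operator =
  fixes M :: "'a measure" and F :: "('a \<Rightarrow> complex) \<Rightarrow> ('a \<Rightarrow> complex)"
  assumes square_integrable: "u \<in> square_integrable M \<Longrightarrow> F u \<in> square_integrable M"
    and cong_AE: "\<lbrakk>u \<in> square_integrable M; v \<in> square_integrable M; AE x in M. u x = v x\<rbrakk>
      \<Longrightarrow> AE x in M. F u x = F v x"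
    and diff: "\<lbrakk>u \<in> square_integrable M; v \<in> square_integrable M\<rbrakk>
      \<Longrightarrow> AE x in M. F (\<lambda>x. u x - v x) x = F u x - F v x"
begin

lemma square_integrable_shift:
  "u \<in> square_integrable M \<Longrightarrow> (\<lambda>x. F u x - c * u x) \<in> square_integrable M"
  by (intro square_integrable_minus square_integrable square_integrable_scale)

lemma lift_class:
  assumes "u \<in> square_integrable M"
  shows "L2_lift M F (L2_class M u) = L2_class M (F u)"
  using assms by (intro L2_lift_class) (auto simp: in_L2_class_iff square_integrable cong_AE)

lemma shift_class:
  assumes "u \<in> square_integrable M"
  shows "L2_minus M (L2_lift M F (L2_class M u)) (L2_scale M c (L2_class M u)) =
    L2_class M (\<lambda>x. F u x - c * u x)"
  using assms
  by (simp add: lift_class L2_scale_class L2_minus_class square_integrable square_integrable_scale)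

lemma eigenvalue_iff:
  "L2_eigenvalue M (L2_lift M F) c \<longleftrightarrow>
    (\<exists>u\<in>square_integrable M. \<not> (AE x in M. u x = 0) \<and> (AE x in M. F u x - c * u x = 0))"
proof -
  have zero: "(\<lambda>x. 0) \<in> square_integrable M" by (simp add: square_integrable_def)
  have 1: "L2_class M u \<noteq> L2_zero M \<longleftrightarrow> \<not> (AE x in M. u x = 0)"
    and 2: "L2_lift M F (L2_class M u) = L2_scale M c (L2_class M u) \<longleftrightarrow>
      (AE x in M. F u x - c * u x = 0)"
    if u: "u \<in> square_integrable M" for u
    by (simp_all add: L2_zero_def L2_class_eq_iff[OF u zero] lift_class[OF u] L2_scale_class[OF u]
        L2_class_eq_iff[OF square_integrable[OF u] square_integrable_scale[OF u]])
  show ?thesis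
  proof
    assume "L2_eigenvalue M (L2_lift M F) c"
    then obtain U where U: "U \<in> L2 M" "U \<noteq> L2_zero M" "L2_lift M F U = L2_scale M c U"
      by (auto simp: L2_eigenvalue_def)
    from U(1) obtain u where "u \<in> square_integrable M" "U = L2_class M u" by (rule L2_cases)
    with U 1 2 show "\<exists>u\<in>square_integrable M. \<not> (AE x in M. u x = 0) \<and>
        (AE x in M. F u x - c * u x = 0)" by metis
  next
    assume "\<exists>u\<in>square_integrable M. \<not> (AE x in M. u x = 0) \<and> (AE x in M. F u x - c * u x = 0)"
    then show "L2_eigenvalue M (L2_lift M F) c"
      using 1 2 L2_class_in unfolding L2_eigenvalue_def by metis
  qed
qed

lemma bounded_below_if_not_spectrum:
  assumes "c \<notin> L2_spectrum M (L2_lift M F)"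
  obtains C where "\<And>u. u \<in> square_integrable M \<Longrightarrow>
    sqrt (LINT x|M. (cmod (u x))\<^sup>2) \<le> C * sqrt (LINT x|M. (cmod (F u x - c * u x))\<^sup>2)"
proof -
  obtain C where C: "\<And>U. U \<in> L2 M \<Longrightarrow>
      L2_norm M U \<le> C * L2_norm M (L2_minus M (L2_lift M F U) (L2_scale M c U))"
    using assms by (auto simp: L2_spectrum_def)
  show ?thesis
  proof (rule that)
    fix u assume u: "u \<in> square_integrable M"
    show "sqrt (LINT x|M. (cmod (u x))\<^sup>2) \<le> C * sqrt (LINT x|M. (cmod (F u x - c * u x))\<^sup>2)"
      using C[OF L2_class_in[OF u]]
      by (simp only: shift_class[OF u] L2_norm_class[OF u] L2_norm_class[OF square_integrable_shift[OF u]])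
  qed
qed

lemma not_spectrumI:
  assumes surj: "\<And>f. f \<in> square_integrable M \<Longrightarrow>
      \<exists>u\<in>square_integrable M. AE x in M. F u x - c * u x = f x"
    and below: "\<And>u. u \<in> square_integrable M \<Longrightarrow>
      (LINT x|M. (cmod (u x))\<^sup>2) \<le> C * (LINT x|M. (cmod (F u x - c * u x))\<^sup>2)"
  shows "c \<notin> L2_spectrum M (L2_lift M F)"
proof -
  let ?D = "\<lambda>U. L2_minus M (L2_lift M F U) (L2_scale M c U)"
  have "\<exists>C. \<forall>U\<in>L2 M. L2_norm M U \<le> C * L2_norm M (?D U)"
  proof (intro exI ballI)
    fix U assume "U \<in> L2 M"
    then obtain u where u: "u \<in> square_integrable M" and U: "U = L2_class M u" by (rule L2_cases)
    have "sqrt (LINT x|M. (cmod (u x))\<^sup>2) \<le>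
        sqrt (C * (LINT x|M. (cmod (F u x - c * u x))\<^sup>2))"
      using below[OF u] by simp
    then show "L2_norm M U \<le> sqrt C * L2_norm M (?D U)"
      by (simp only: U shift_class[OF u] L2_norm_class[OF u]
          L2_norm_class[OF square_integrable_shift[OF u]] real_sqrt_mult)
  qed
  moreover have "bij_betw ?D (L2 M) (L2 M)"
  proof (rule bij_betw_imageI)
    show "inj_on ?D (L2 M)"
    proof (rule inj_onI)
      fix U V assume "U \<in> L2 M" "V \<in> L2 M" and eq: "?D U = ?D V"
      then obtain u v where u: "u \<in> square_integrable M" and U: "U = L2_class M u"
        and v: "v \<in> square_integrable M" and V: "V = L2_class M v" by (metis L2_cases)
      define d where "d x = u x - v x" for x
      have d: "d \<in> square_integrable M"
        using square_integrable_minus[OF u v] by (simp add: d_def[abs_def])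
      have "AE x in M. F u x - c * u x = F v x - c * v x"
        using eq by (simp add: U V shift_class u v L2_class_eq_iff square_integrable_shift)
      moreover have "AE x in M. F d x = F u x - F v x"
        using diff[OF u v] by (simp add: d_def[abs_def])
      ultimately have "AE x in M. (cmod (F d x - c * d x))\<^sup>2 = 0"
      proof eventually_elim
        case (elim x)
        have "F d x - c * d x = (F u x - c * u x) - (F v x - c * v x)"
          unfolding elim(2) by (simp add: d_def right_diff_distrib)
        then show ?case using elim(1) by simp
      qed
      then have "(LINT x|M. (cmod (F d x - c * d x))\<^sup>2) = 0"
        by (rule integral_eq_zero_AE)
      with below[OF d] have "(LINT x|M. (cmod (d x))\<^sup>2) \<le> 0" by simp
      then have "(LINT x|M. (cmod (d x))\<^sup>2) = 0" by (simp add: antisym)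
      then have "AE x in M. (cmod (d x))\<^sup>2 = 0"
        using d by (subst (asm) integral_nonneg_eq_0_iff_AE) (auto simp: square_integrable_def)
      then have "AE x in M. u x = v x" by (simp add: d_def)
      then show "U = V" by (simp add: U V L2_class_eq_iff u v)
    qed
    show "?D ` L2 M = L2 M"
    proof
      show "?D ` L2 M \<subseteq> L2 M"
        by (auto elim!: L2_cases simp: shift_class intro!: L2_class_in square_integrable_shift)
      show "L2 M \<subseteq> ?D ` L2 M"
      proof
        fix V assume "V \<in> L2 M"
        then obtain f where f: "f \<in> square_integrable M" and V: "V = L2_class M f" by (rule L2_cases)
        from surj[OF f] obtain u where u: "u \<in> square_integrable M"
          and eq: "AE x in M. F u x - c * u x = f x" by blast
        have "?D (L2_class M u) = V"
          using eq by (simp add: V shift_class u f L2_class_eq_iff square_integrable_shift)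
        then show "V \<in> ?D ` L2 M" using L2_class_in[OF u] by blast
      qed
    qed
  qed
  ultimately show ?thesis by (simp add: L2_spectrum_def)
qed

lemma eigenvalue_in_spectrum:
  assumes "L2_eigenvalue M (L2_lift M F) c"
  shows "c \<in> L2_spectrum M (L2_lift M F)"
proof (rule ccontr)
  assume "c \<notin> L2_spectrum M (L2_lift M F)"
  then obtain C where C: "\<And>u. u \<in> square_integrable M \<Longrightarrow>
      sqrt (LINT x|M. (cmod (u x))\<^sup>2) \<le> C * sqrt (LINT x|M. (cmod (F u x - c * u x))\<^sup>2)"
    by (rule bounded_below_if_not_spectrum) blast
  obtain u where u: "u \<in> square_integrable M" and nz: "\<not> (AE x in M. u x = 0)"
    and eq: "AE x in M. F u x - c * u x = 0"
    using assms by (auto simp: eigenvalue_iff)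
  from eq have "AE x in M. (cmod (F u x - c * u x))\<^sup>2 = 0" by eventually_elim simp
  then have "(LINT x|M. (cmod (F u x - c * u x))\<^sup>2) = 0"
    by (rule integral_eq_zero_AE)
  with C[OF u] have "(LINT x|M. (cmod (u x))\<^sup>2) \<le> 0" by simp
  then have "(LINT x|M. (cmod (u x))\<^sup>2) = 0" by (simp add: antisym)
  then have "AE x in M. (cmod (u x))\<^sup>2 = 0"
    using u by (subst (asm) integral_nonneg_eq_0_iff_AE) (auto simp: square_integrable_def)
  with nz show False by simp
qed

end

section \<open>Square integrable functions\<close>

lemma (in finite_measure) square_integrable_imp_integrable_cmod:
  assumes "u \<in> square_integrable M"
  shows "integrable M u"
proof -
  have [measurable]: "u \<in> borel_measurable M" and sq: "integrable M (\<lambda>x. (cmod (u x))\<^sup>2)"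
    using assms by (auto simp: square_integrable_def)
  have "integrable M (\<lambda>x. cmod (u x))"
    by (rule square_integrable_imp_integrable[OF _ sq]) measurable
  then show ?thesis by (rule integrable_norm_cancel) measurable
qed

lemma (in finite_measure) integral_cmod_power2_le:
  assumes u: "u \<in> square_integrable M"
  shows "(LINT x|M. cmod (u x))\<^sup>2 \<le> measure M (space M) * (LINT x|M. (cmod (u x))\<^sup>2)"
proof (cases "measure M (space M) = 0")
  case True
  then have "space M \<in> null_sets M" by (auto simp: null_sets_def emeasure_eq_measure)
  then have "AE x in M. cmod (u x) = 0"
    using AE_iff_null_sets by (metis (mono_tags, lifting) AE_I' mem_Collect_eq subsetI)
  then have "(LINT x|M. cmod (u x)) = 0" by (rule integral_eq_zero_AE)
  with True show ?thesis by simp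
next
  case False
  define \<mu> where "\<mu> = measure M (space M)"
  define a where "a = (LINT x|M. cmod (u x))"
  have \<mu>: "\<mu> > 0" using False by (simp add: \<mu>_def zero_less_measure_iff)
  have i1: "integrable M (\<lambda>x. cmod (u x))"
    using square_integrable_imp_integrable_cmod[OF u] by simp
  have i2: "integrable M (\<lambda>x. (cmod (u x))\<^sup>2)"
    using u by (simp add: square_integrable_def)
  \<comment> \<open>the variance of \<open>cmod u\<close> is nonnegative\<close>
  have "0 \<le> (LINT x|M. (\<mu> * cmod (u x) - a)\<^sup>2)" by simp
  also have "\<dots> = (LINT x|M. \<mu>\<^sup>2 * (cmod (u x))\<^sup>2 - (2 * \<mu> * a) * cmod (u x) + a\<^sup>2)"
    by (simp add: power2_diff power_mult_distrib algebra_simps)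
  also have "\<dots> = \<mu>\<^sup>2 * (LINT x|M. (cmod (u x))\<^sup>2) - (2 * \<mu> * a) * a + \<mu> * a\<^sup>2"
    using i1 i2 by (simp add: a_def \<mu>_def)
  also have "\<dots> = \<mu> * (\<mu> * (LINT x|M. (cmod (u x))\<^sup>2) - a\<^sup>2)"
    by (simp add: power2_eq_square algebra_simps)
  finally show ?thesis
    using \<mu> by (simp add: zero_le_mult_iff a_def \<mu>_def)
qed

lemma (in finite_measure) square_integrable_if_bounded:
  assumes [measurable]: "u \<in> borel_measurable M" and "AE x in M. cmod (u x) \<le> B"
  shows "u \<in> square_integrable M"
proof -
  have "integrable M (\<lambda>x. (cmod (u x))\<^sup>2)"
  proof (rule integrable_const_bound)
    show "AE x in M. norm ((cmod (u x))\<^sup>2) \<le> B\<^sup>2"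
      using assms(2) by eventually_elim (simp add: power_mono)
  qed measurable
  then show ?thesis by (simp add: square_integrable_def)
qed

lemma square_integrable_add:
  assumes "u \<in> square_integrable M" "v \<in> square_integrable M"
  shows "(\<lambda>x. u x + v x) \<in> square_integrable M"
  using square_integrable_minus[OF assms(1) square_integrable_scale[OF assms(2), of "-1"]] by simp

lemma square_integrable_mult_bounded:
  assumes u: "u \<in> square_integrable M" and [measurable]: "g \<in> borel_measurable M"
    and g: "AE x in M. cmod (g x) \<le> B"
  shows "(\<lambda>x. g x * u x) \<in> square_integrable M"
proof -
  have [measurable]: "u \<in> borel_measurable M" using u by (simp add: square_integrable_def)
  have "integrable M (\<lambda>x. (cmod (g x * u x))\<^sup>2)"
  proof (rule Bochner_Integration.integrable_bound)
    show "integrable M (\<lambda>x. B\<^sup>2 * (cmod (u x))\<^sup>2)"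
      using u by (auto simp: square_integrable_def)
    show "AE x in M. norm ((cmod (g x * u x))\<^sup>2) \<le> norm (B\<^sup>2 * (cmod (u x))\<^sup>2)"
      using g by eventually_elim
        (simp add: norm_mult power_mult_distrib mult_right_mono power_mono)
  qed measurable
  then show ?thesis by (simp add: square_integrable_def)
qed

section \<open>Integral operators with a continuous symmetric kernel\<close>

text \<open>
  The kernel is continuous on the whole space, so that the integral operator below turns integrable
  functions on \<open>\<Omega>\<close> into continuous functions on the whole space.
\<close>

locale continuous_kernel =
  fixes \<Omega> :: "'a::euclidean_space set" and k :: "'a \<Rightarrow> 'a \<Rightarrow> real"
  assumes open_\<Omega>: "open \<Omega>" and bounded_\<Omega>: "bounded \<Omega>"
    and continuous_k: "continuous_on UNIV (\<lambda>p. k (fst p) (snd p))"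
    and k_sym: "k x y = k y x"
begin

abbreviation M :: "'a measure" where "M \<equiv> lebesgue_on \<Omega>"

text \<open>
  The integral operator with kernel \<open>k\<close>. Integration is over \<open>\<Omega>\<close>, but \<open>K u x\<close> is defined for all \<open>x\<close>.
\<close>

definition K :: "('a \<Rightarrow> complex) \<Rightarrow> 'a \<Rightarrow> complex" where
  "K u x = (LINT y|M. complex_of_real (k x y) * u y)"

sublocale finite_measure M
  using open_\<Omega> bounded_\<Omega> by (intro finite_measure_lebesgue_on lmeasurable_open)

lemma \<Omega>_sets [measurable, simp]: "\<Omega> \<in> sets lebesgue"
  using open_\<Omega> by (simp add: borel_open)

lemma compact_closure_\<Omega>: "compact (closure \<Omega>)"
  using bounded_\<Omega> by simp

lemma measurable_if_continuous:
  assumes "continuous_on \<Omega> (f :: 'a \<Rightarrow> 'b::real_normed_vector)"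
  shows "f \<in> borel_measurable M"
  using assms by (intro continuous_imp_measurable_on_sets_lebesgue) simp_all

lemma k_compose:
  assumes "continuous_on S f" "continuous_on S g"
  shows "continuous_on S (\<lambda>x. k (f x) (g x))"
  using continuous_on_compose2[OF continuous_k continuous_on_Pair[OF assms]] by simp

lemma k_measurable [measurable]: "(\<lambda>y. k x y) \<in> borel_measurable M"
  by (intro measurable_if_continuous k_compose continuous_intros)

lemma k_bounded:
  assumes "compact S"
  obtains B where "B > 0" "\<And>x y. x \<in> S \<Longrightarrow> y \<in> closure \<Omega> \<Longrightarrow> \<bar>k x y\<bar> \<le> B"
proof -
  have "compact ((\<lambda>p. k (fst p) (snd p)) ` (S \<times> closure \<Omega>))"
    using assms compact_closure_\<Omega>
    by (intro compact_continuous_image compact_Times continuous_on_subset[OF continuous_k]) auto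
  then have "bounded ((\<lambda>p. k (fst p) (snd p)) ` (S \<times> closure \<Omega>))" by (rule compact_imp_bounded)
  then obtain B where "B > 0" "\<forall>p\<in>S \<times> closure \<Omega>. \<bar>k (fst p) (snd p)\<bar> \<le> B"
    by (force simp: bounded_pos)
  then show ?thesis by (intro that[of B]) auto
qed

lemma k_equicontinuous:
  assumes "e > 0"
  obtains d where "d > 0" "\<And>x' y. dist x' x < d \<Longrightarrow> y \<in> \<Omega> \<Longrightarrow> \<bar>k x' y - k x y\<bar> \<le> e"
proof -
  have "uniformly_continuous_on (cball x 1 \<times> closure \<Omega>) (\<lambda>p. k (fst p) (snd p))"
    using compact_closure_\<Omega>
    by (intro compact_uniformly_continuous compact_Times continuous_on_subset[OF continuous_k]) auto
  then obtain d where d: "d > 0" "\<And>p p'. \<lbrakk>p \<in> cball x 1 \<times> closure \<Omega>; p' \<in> cball x 1 \<times> closure \<Omega>;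
      dist p' p < d\<rbrakk> \<Longrightarrow> dist (k (fst p') (snd p')) (k (fst p) (snd p)) < e"
    using assms unfolding uniformly_continuous_on_def by metis
  show ?thesis
  proof (rule that[of "min d 1"])
    fix x' y assume "dist x' x < min d 1" "y \<in> \<Omega>"
    moreover have "y \<in> closure \<Omega>" using \<open>y \<in> \<Omega>\<close> closure_subset by blast
    moreover have "dist (x', y) (x, y) = dist x' x" by (simp add: dist_Pair_Pair)
    ultimately show "\<bar>k x' y - k x y\<bar> \<le> e"
      using d(2)[of "(x, y)" "(x', y)"] by (simp add: dist_real_def dist_commute)
  qed (use d in simp)
qed

lemma integrable_k_mult:
  assumes "integrable M u"
  shows "integrable M (\<lambda>y. complex_of_real (k x y) * u y)"
proof -
  have [measurable]: "u \<in> borel_measurable M" using assms by simp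
  obtain B where B: "B > 0" "\<And>y. y \<in> closure \<Omega> \<Longrightarrow> \<bar>k x y\<bar> \<le> B"
    by (rule k_bounded[of "{x}"]) auto
  show ?thesis
  proof (rule Bochner_Integration.integrable_bound)
    show "integrable M (\<lambda>y. B * cmod (u y))" using assms by simp
    show "AE y in M. norm (complex_of_real (k x y) * u y) \<le> norm (B * cmod (u y))"
      using B closure_subset by (intro AE_I2) (auto simp: norm_mult intro!: mult_right_mono)
  qed measurable
qed

lemma K_bound:
  assumes u: "integrable M u" and B: "\<And>y. y \<in> \<Omega> \<Longrightarrow> \<bar>k x y\<bar> \<le> B"
  shows "cmod (K u x) \<le> B * (LINT y|M. cmod (u y))"
proof -
  have "cmod (K u x) \<le> (LINT y|M. cmod (complex_of_real (k x y) * u y))"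
    unfolding K_def by (rule integral_norm_bound)
  also have "\<dots> \<le> (LINT y|M. B * cmod (u y))"
    using u B integrable_k_mult[OF u, of x]
    by (intro integral_mono integrable_norm) (auto simp: norm_mult intro!: mult_right_mono)
  finally show ?thesis by simp
qed

lemma K_diff_bound:
  assumes u: "integrable M u" and e: "\<And>y. y \<in> \<Omega> \<Longrightarrow> \<bar>k x' y - k x y\<bar> \<le> e"
  shows "cmod (K u x' - K u x) \<le> e * (LINT y|M. cmod (u y))"
proof -
  have "K u x' - K u x = (LINT y|M. complex_of_real (k x' y) * u y - complex_of_real (k x y) * u y)"
    unfolding K_def using integrable_k_mult[OF u] by simp
  also have "cmod \<dots> \<le> (LINT y|M. cmod (complex_of_real (k x' y) * u y - complex_of_real (k x y) * u y))"
    by (rule integral_norm_bound)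
  also have "\<dots> \<le> (LINT y|M. e * cmod (u y))"
  proof (rule integral_mono)
    fix y assume "y \<in> space M"
    then have "\<bar>k x' y - k x y\<bar> \<le> e" using e by simp
    then show "cmod (complex_of_real (k x' y) * u y - complex_of_real (k x y) * u y) \<le> e * cmod (u y)"
      by (simp add: norm_mult mult_right_mono flip: left_diff_distrib of_real_diff)
  qed (use u integrable_k_mult[OF u] in auto)
  finally show ?thesis by simp
qed

text \<open>
  The images of an \<open>L\<^sup>1\<close> ball are equicontinuous: \<open>d\<close> does not depend on \<open>u\<close>.
\<close>

lemma K_equicontinuous:
  assumes "e > 0"
  obtains d where "d > 0" "\<And>u x'. \<lbrakk>integrable M u; (LINT y|M. cmod (u y)) \<le> L; dist x' x < d\<rbrakk>
    \<Longrightarrow> cmod (K u x' - K u x) < e"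
proof -
  have "e / (2 * (\<bar>L\<bar> + 1)) > 0" using assms by simp
  then obtain d where d: "d > 0"
    "\<And>x' y. dist x' x < d \<Longrightarrow> y \<in> \<Omega> \<Longrightarrow> \<bar>k x' y - k x y\<bar> \<le> e / (2 * (\<bar>L\<bar> + 1))"
    by (rule k_equicontinuous[where x = x]) blast
  show ?thesis
  proof (rule that[OF d(1)])
    fix u x' assume u: "integrable M u" "(LINT y|M. cmod (u y)) \<le> L" and x': "dist x' x < d"
    have "cmod (K u x' - K u x) \<le> e / (2 * (\<bar>L\<bar> + 1)) * (LINT y|M. cmod (u y))"
      using d(2)[OF x'] by (rule K_diff_bound[OF u(1)])
    also have "\<dots> \<le> e / (2 * (\<bar>L\<bar> + 1)) * (\<bar>L\<bar> + 1)"
      using u(2) assms by (intro mult_left_mono) auto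
    also have "\<dots> < e" using assms by (auto simp: field_simps intro!: add_pos_nonneg)
    finally show "cmod (K u x' - K u x) < e" .
  qed
qed

lemma continuous_on_K:
  assumes "integrable M u"
  shows "continuous_on S (K u)"
proof -
  have "isCont (K u) x" for x
    unfolding continuous_at_eps_delta
  proof (intro allI impI)
    fix e :: real assume "e > 0"
    then obtain d where "d > 0" "\<And>x'. dist x' x < d \<Longrightarrow> cmod (K u x' - K u x) < e"
      by (rule K_equicontinuous[where L = "LINT y|M. cmod (u y)" and x = x]) (use assms in auto)
    then show "\<exists>d>0. \<forall>x'. dist x' x < d \<longrightarrow> dist (K u x') (K u x) < e"
      by (auto simp: dist_norm)
  qed
  then show ?thesis by (simp add: continuous_at_imp_continuous_on)
qed

lemma K_minus:
  assumes "integrable M u" "integrable M v"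
  shows "K (\<lambda>x. u x - v x) x = K u x - K v x"
  using integrable_k_mult[OF assms(1)] integrable_k_mult[OF assms(2)]
  by (simp add: K_def right_diff_distrib)

lemma K_plus:
  assumes "integrable M u" "integrable M v"
  shows "K (\<lambda>x. u x + v x) x = K u x + K v x"
  using integrable_k_mult[OF assms(1)] integrable_k_mult[OF assms(2)]
  by (simp add: K_def distrib_left)

lemma K_scale: "K (\<lambda>x. c * u x) x = c * K u x"
  unfolding K_def by (subst integral_mult_right_zero[symmetric]) (simp add: ac_simps)

lemma K_cong_AE:
  assumes "u \<in> borel_measurable M" "v \<in> borel_measurable M" "AE x in M. u x = v x"
  shows "K u x = K v x"
  unfolding K_def
proof (rule integral_cong_AE)
  show "AE y in M. complex_of_real (k x y) * u y = complex_of_real (k x y) * v y"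
    using assms(3) by eventually_elim simp
qed (use assms in measurable)

lemma K_compact:
  assumes "compact S" and u: "\<And>n. integrable M (u n)" "\<And>n. (LINT y|M. cmod (u n y)) \<le> L"
  obtains g r where "continuous_on S g" "strict_mono (r :: nat \<Rightarrow> nat)"
    "\<And>e. e > 0 \<Longrightarrow> \<exists>N. \<forall>n x. n \<ge> N \<and> x \<in> S \<longrightarrow> cmod (K (u (r n)) x - g x) < e"
proof -
  obtain B where B: "B > 0" "\<And>x y. x \<in> S \<Longrightarrow> y \<in> closure \<Omega> \<Longrightarrow> \<bar>k x y\<bar> \<le> B"
    by (rule k_bounded[OF assms(1)]) blast
  show ?thesis
  proof (rule Arzela_Ascoli[of S "\<lambda>n. K (u n)" "B * L"])
    fix n x assume x: "x \<in> S"
    have "cmod (K (u n) x) \<le> B * (LINT y|M. cmod (u n y))"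
      using B(2)[OF x] closure_subset by (intro K_bound u(1)) blast
    also have "\<dots> \<le> B * L" using u(2) B(1) by simp
    finally show "cmod (K (u n) x) \<le> B * L" .
  next
    fix x and e :: real assume "e > 0"
    then obtain d where "d > 0" and d: "\<And>u x'. \<lbrakk>integrable M u; (LINT y|M. cmod (u y)) \<le> L; dist x' x < d\<rbrakk>
        \<Longrightarrow> cmod (K u x' - K u x) < e"
      by (rule K_equicontinuous[where x = x and L = L]) blast
    then show "\<exists>d>0. \<forall>n y. y \<in> S \<and> norm (x - y) < d \<longrightarrow> cmod (K (u n) x - K (u n) y) < e"
      using u by (intro exI[of _ d]) (auto simp: dist_norm norm_minus_commute)
  qed (use assms(1) that in blast)+
qed

lemma continuous_imp_square_integrable:
  assumes "continuous_on UNIV u"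
  shows "u \<in> square_integrable M"
proof -
  have "bounded (u ` closure \<Omega>)"
    using assms compact_closure_\<Omega> by (intro compact_imp_bounded compact_continuous_image)
      (auto intro: continuous_on_subset)
  then obtain B where B: "\<And>x. x \<in> closure \<Omega> \<Longrightarrow> cmod (u x) \<le> B"
    by (auto simp: bounded_iff)
  show ?thesis
  proof (rule square_integrable_if_bounded)
    show "u \<in> borel_measurable M"
      using assms by (intro measurable_if_continuous) (auto intro: continuous_on_subset)
    show "AE x in M. cmod (u x) \<le> B" using B closure_subset by (intro AE_I2) auto
  qed
qed

text \<open>
  Symmetry of the kernel and Fubini's theorem.
\<close>

lemma K_symmetric:
  assumes u: "u \<in> square_integrable M" and v: "v \<in> square_integrable M"
  shows "(LINT x|M. K u x * cnj (v x)) = (LINT x|M. u x * cnj (K v x))"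
proof -
  interpret pair_sigma_finite M M ..
  have [measurable]: "u \<in> borel_measurable M" "v \<in> borel_measurable M"
    using u v by (auto simp: square_integrable_def)
  have ui: "integrable M (\<lambda>x. cmod (u x))" and vi: "integrable M (\<lambda>x. cmod (v x))"
    using square_integrable_imp_integrable_cmod u v by auto
  define f where "f x y = complex_of_real (k x y) * u y * cnj (v x)" for x y
  obtain B where B: "B > 0" "\<And>x y. x \<in> closure \<Omega> \<Longrightarrow> y \<in> closure \<Omega> \<Longrightarrow> \<bar>k x y\<bar> \<le> B"
    by (rule k_bounded[OF compact_closure_\<Omega>]) blast
  have id_M [measurable]: "(\<lambda>x. x) \<in> M \<rightarrow>\<^sub>M borel"
    by (intro measurable_if_continuous continuous_intros)
  have k_borel: "(\<lambda>p. k (fst p) (snd p)) \<in> borel_measurable (borel \<Otimes>\<^sub>M borel)"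
    using borel_measurable_continuous_onI[OF continuous_k] by (simp add: borel_prod)
  have "(\<lambda>p. (fst p, snd p)) \<in> M \<Otimes>\<^sub>M M \<rightarrow>\<^sub>M borel \<Otimes>\<^sub>M borel"
    by measurable
  from measurable_compose[OF this k_borel]
  have k_meas [measurable]: "(\<lambda>p. k (fst p) (snd p)) \<in> borel_measurable (M \<Otimes>\<^sub>M M)"
    by simp
  have [measurable]: "cnj \<in> borel_measurable borel"
    by (intro borel_measurable_continuous_onI continuous_intros)
  have f_meas [measurable]: "case_prod f \<in> borel_measurable (M \<Otimes>\<^sub>M M)"
    unfolding f_def split_beta by measurable
  have f_le: "cmod (f x y) \<le> B * (cmod (v x) * cmod (u y))" if "x \<in> \<Omega>" "y \<in> \<Omega>" for x y
  proof -
    have "\<bar>k x y\<bar> * (cmod (v x) * cmod (u y)) \<le> B * (cmod (v x) * cmod (u y))"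
      using that closure_subset by (intro mult_right_mono B) auto
    then show ?thesis by (simp add: f_def norm_mult ac_simps)
  qed
  have fy: "integrable M (\<lambda>y. f x y)" for x
    unfolding f_def using integrable_k_mult[of u x] square_integrable_imp_integrable_cmod[OF u] by simp
  have "integrable (M \<Otimes>\<^sub>M M) (case_prod f)"
  proof (rule Fubini_integrable)
    show "integrable M (\<lambda>x. LINT y|M. norm (case (x, y) of (x, y) \<Rightarrow> f x y))"
    proof (rule Bochner_Integration.integrable_bound)
      show "integrable M (\<lambda>x. B * (LINT y|M. cmod (u y)) * cmod (v x))" using vi by simp
      have "(LINT y|M. cmod (f x y)) \<le> B * (LINT y|M. cmod (u y)) * cmod (v x)" if "x \<in> \<Omega>" for x
      proof -
        have "(LINT y|M. cmod (f x y)) \<le> (LINT y|M. B * (cmod (v x) * cmod (u y)))"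
          using fy ui f_le that by (intro integral_mono) auto
        then show ?thesis by (simp add: ac_simps)
      qed
      then show "AE x in M. norm (LINT y|M. norm (case (x, y) of (x, y) \<Rightarrow> f x y))
          \<le> norm (B * (LINT y|M. cmod (u y)) * cmod (v x))"
        by (intro AE_I2) (force simp: abs_of_nonneg)
    qed measurable
  qed (use fy in auto)
  then have "(LINT y|M. LINT x|M. f x y) = (LINT x|M. LINT y|M. f x y)"
    by (rule Fubini_integral)
  moreover have "(LINT y|M. f x y) = K u x * cnj (v x)" for x
    by (simp add: f_def K_def)
  moreover have "(LINT x|M. f x y) = u y * cnj (K v y)" for y
  proof -
    have "(LINT x|M. f x y) = (LINT x|M. u y * cnj (complex_of_real (k y x) * v x))"
      by (simp add: f_def k_sym[of y] ac_simps)
    also have "\<dots> = u y * cnj (K v y)"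
      unfolding K_def integral_mult_right_zero
      by (subst Bochner_Integration.integral_cnj) (rule refl)
    finally show ?thesis .
  qed
  ultimately show ?thesis by simp
qed

end

section \<open>Integral operators plus multiplication operators\<close>

locale kernel_plus_multiplier = continuous_kernel \<Omega> k
  for \<Omega> :: "'a::euclidean_space set" and k +
  fixes b :: "'a \<Rightarrow> real"
  assumes continuous_b: "continuous_on (closure \<Omega>) b"
begin

text \<open>
  The sum of the integral operator and multiplication by \<open>b\<close>. Only the values of \<open>b\<close> on the closure of
  \<open>\<Omega>\<close> are constrained.
\<close>

definition N :: "('a \<Rightarrow> complex) \<Rightarrow> 'a \<Rightarrow> complex" where
  "N u x = K u x + complex_of_real (b x) * u x"

lemma b_measurable [measurable]: "b \<in> borel_measurable M"
  using continuous_on_subset[OF continuous_b closure_subset] by (rule measurable_if_continuous)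

lemma b_mult_square_integrable:
  assumes "u \<in> square_integrable M"
  shows "(\<lambda>x. complex_of_real (b x) * u x) \<in> square_integrable M"
proof -
  have "bounded (b ` closure \<Omega>)"
    using continuous_b compact_closure_\<Omega> by (intro compact_imp_bounded compact_continuous_image)
  then obtain B where B: "\<And>x. x \<in> closure \<Omega> \<Longrightarrow> \<bar>b x\<bar> \<le> B"
    by (auto simp: bounded_iff)
  then have "AE x in M. cmod (complex_of_real (b x)) \<le> B"
    using closure_subset by (intro AE_I2) auto
  then show ?thesis
    by (intro square_integrable_mult_bounded[OF assms]) auto
qed

lemma K_square_integrable: "u \<in> square_integrable M \<Longrightarrow> K u \<in> square_integrable M"
  by (rule continuous_imp_square_integrable[OF continuous_on_K[OF square_integrable_imp_integrable_cmod]])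

sublocale L2_operator M N
proof
  fix u v assume u: "u \<in> square_integrable M"
  show "N u \<in> square_integrable M"
    using square_integrable_add[OF K_square_integrable[OF u] b_mult_square_integrable[OF u]]
    by (simp add: N_def[abs_def])
  assume v: "v \<in> square_integrable M"
  show "AE x in M. N (\<lambda>x. u x - v x) x = N u x - N v x"
    using K_minus[OF square_integrable_imp_integrable_cmod[OF u] square_integrable_imp_integrable_cmod[OF v]]
    by (simp add: N_def algebra_simps)
  assume uv: "AE x in M. u x = v x"
  moreover have "K u x = K v x" for x
    using u v uv by (intro K_cong_AE) (auto simp: square_integrable_def)
  ultimately show "AE x in M. N u x = N v x"
    by (auto simp: N_def)
qed

text \<open>
  The range of \<open>b\<close> on the closure of \<open>\<Omega>\<close> is compact, so every other point has positive distance from it.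
\<close>

lemma multiplier_gap:
  assumes "c \<notin> complex_of_real ` b ` closure \<Omega>"
  obtains \<delta> where "\<delta> > 0" "\<And>x. x \<in> closure \<Omega> \<Longrightarrow> \<delta> \<le> cmod (complex_of_real (b x) - c)"
proof -
  have "compact (complex_of_real ` b ` closure \<Omega>)"
    using continuous_b compact_closure_\<Omega>
    by (intro compact_continuous_image continuous_intros continuous_on_id) auto
  then have "closed (complex_of_real ` b ` closure \<Omega>)" by (rule compact_imp_closed)
  from separate_point_closed[OF this assms] obtain \<delta> where
    "\<delta> > 0" "\<forall>x\<in>complex_of_real ` b ` closure \<Omega>. \<delta> \<le> dist c x" by blast
  then show ?thesis by (intro that[of \<delta>]) (auto simp: dist_norm norm_minus_commute)
qed

text \<open>
  The Fredholm alternative is applied in the space of bounded continuous functions on the whole space.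
  Arzela-Ascoli needs a compact domain; therefore functions \<open>K u\<close> are composed with the projection \<open>P\<close>
  onto a closed ball \<open>S\<close> that contains \<open>\<Omega>\<close>. This changes nothing on \<open>\<Omega>\<close>.
\<close>

theorem not_spectrum_if_not_eigenvalue:
  assumes c: "c \<notin> complex_of_real ` b ` closure \<Omega>"
    and not_ev: "\<not> L2_eigenvalue M (L2_lift M N) c"
  shows "c \<notin> L2_spectrum M (L2_lift M N)"
proof -
  obtain \<delta> where \<delta>: "\<delta> > 0" "\<And>x. x \<in> closure \<Omega> \<Longrightarrow> \<delta> \<le> cmod (complex_of_real (b x) - c)"
    by (rule multiplier_gap[OF c]) blast
  define g where "g x = 1 / (complex_of_real (b x) - c)" for x
  have [measurable]: "g \<in> borel_measurable M" unfolding g_def by measurable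
  have nz: "complex_of_real (b x) - c \<noteq> 0" if "x \<in> \<Omega>" for x
  proof -
    have "\<delta> \<le> cmod (complex_of_real (b x) - c)" using \<delta>(2) closure_subset that by blast
    then show ?thesis using \<delta>(1) by auto
  qed
  have g_le: "cmod (g x) \<le> 1 / \<delta>" if "x \<in> \<Omega>" for x
  proof -
    have "\<delta> \<le> cmod (complex_of_real (b x) - c)" using \<delta>(2) closure_subset that by blast
    then show ?thesis using \<delta>(1) by (simp add: g_def norm_divide frac_le)
  qed
  have bg: "(complex_of_real (b x) - c) * g x = 1" if "x \<in> \<Omega>" for x
    using nz[OF that] by (simp add: g_def)
  have g_AE: "AE x in M. cmod (g x) \<le> 1 / \<delta>" using g_le by (intro AE_I2) simp
  have g_sq: "(\<lambda>x. g x * u x) \<in> square_integrable M" if "u \<in> square_integrable M" for u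
    using that by (rule square_integrable_mult_bounded[OF _ _ g_AE]) measurable
  obtain R where R: "R > 0" "closure \<Omega> \<subseteq> cball 0 R"
    using bounded_subset_ballD[OF bounded_closure[OF bounded_\<Omega>], of 0] ball_subset_cball by blast
  define S where "S = cball (0::'a) R"
  have S: "compact S" "closed S" "convex S" "S \<noteq> {}" using R(1) by (auto simp: S_def)
  define P where "P = closest_point S"
  have P_S: "P x \<in> S" for x using S by (simp add: P_def closest_point_in_set)
  have P_cont: "continuous_on UNIV P"
    unfolding P_def using S by (intro continuous_on_closest_point) auto
  have P_id: "P x = x" if "x \<in> \<Omega>" for x
    using R(2) closure_subset that unfolding P_def S_def by (intro closest_point_self) blast
  obtain B where B: "B > 0" "\<And>x y. x \<in> S \<Longrightarrow> y \<in> closure \<Omega> \<Longrightarrow> \<bar>k x y\<bar> \<le> B"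
    by (rule k_bounded[OF S(1)]) blast
  have K_le: "cmod (K u (P x)) \<le> B * (LINT y|M. cmod (u y))" if "integrable M u" for u x
    using that B(2)[OF P_S[of x]] closure_subset by (intro K_bound) blast+
  define A where "A u = Bcontfun (\<lambda>x. K u (P x))" for u
  have A: "apply_bcontfun (A u) x = K u (P x)" if u: "u \<in> square_integrable M" for u x
  proof -
    note ui = square_integrable_imp_integrable_cmod[OF u]
    have "(\<lambda>x. K u (P x)) \<in> bcontfun"
    proof (rule bcontfun_normI)
      show "continuous_on UNIV (\<lambda>x. K u (P x))"
        by (rule continuous_on_compose2[OF continuous_on_K[OF ui, of UNIV] P_cont]) simp
    qed (rule K_le[OF ui])
    then show ?thesis by (simp add: A_def Bcontfun_inverse)
  qed
  have A_norm: "norm (A u) \<le> B * (LINT y|M. cmod (u y))" if u: "u \<in> square_integrable M" for u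
    using K_le[OF square_integrable_imp_integrable_cmod[OF u]]
    by (intro norm_bound) (simp add: A[OF u])
  have w_sq: "apply_bcontfun w \<in> square_integrable M" for w
    by (intro continuous_imp_square_integrable) simp
  have gw_int: "(LINT y|M. cmod (g y * apply_bcontfun w y)) \<le> measure M (space M) / \<delta> * norm w" for w
  proof -
    have "(LINT y|M. cmod (g y * apply_bcontfun w y)) \<le> (LINT y|M. 1 / \<delta> * norm w)"
    proof (rule integral_mono)
      fix y assume "y \<in> space M"
      then show "cmod (g y * apply_bcontfun w y) \<le> 1 / \<delta> * norm w"
        using g_le[of y] norm_bounded[of w y] \<delta>(1) unfolding norm_mult by (intro mult_mono) auto
    qed (use square_integrable_imp_integrable_cmod[OF g_sq[OF w_sq[of w]]] in auto)
    then show ?thesis by simp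
  qed
  \<comment> \<open>the compact operator whose fixed points \<open>w\<close> correspond to eigenfunctions \<open>g w\<close> for \<open>c\<close>\<close>
  define C where "C w = - A (\<lambda>y. g y * apply_bcontfun w y)" for w
  have C: "apply_bcontfun (C w) x = - K (\<lambda>y. g y * apply_bcontfun w y) (P x)" for w x
    by (simp add: C_def A[OF g_sq[OF w_sq]])
  note gi = square_integrable_imp_integrable_cmod[OF g_sq]
  have C_lin: "bounded_linear C"
  proof (rule bounded_linear_intro)
    fix v w :: "'a \<Rightarrow>\<^sub>C complex" and r :: real
    show "C (v + w) = C v + C w"
      using K_plus[OF gi[OF w_sq[of v]] gi[OF w_sq[of w]]]
      by (intro bcontfun_eqI) (simp add: C distrib_left)
    show "C (r *\<^sub>R w) = r *\<^sub>R C w"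
      using K_scale[of "complex_of_real r" "\<lambda>y. g y * apply_bcontfun w y"]
      by (intro bcontfun_eqI) (simp add: C scaleR_conv_of_real mult.left_commute)
    have "norm (C w) \<le> B * (LINT y|M. cmod (g y * apply_bcontfun w y))"
      using A_norm[OF g_sq[OF w_sq]] by (simp add: C_def)
    also have "\<dots> \<le> B * (measure M (space M) / \<delta> * norm w)"
      using gw_int B(1) by (intro mult_left_mono) auto
    finally show "norm (C w) \<le> norm w * (B * (measure M (space M) / \<delta>))"
      by (simp add: ac_simps)
  qed
  have C_compact: "compact_map C"
    unfolding compact_map_def
  proof (intro allI impI)
    fix w :: "nat \<Rightarrow> 'a \<Rightarrow>\<^sub>C complex" assume "bounded (range w)"
    then obtain D where D: "\<And>n. norm (w n) \<le> D" by (auto simp: bounded_iff)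
    have "(LINT y|M. cmod (g y * apply_bcontfun (w n) y)) \<le> measure M (space M) / \<delta> * D" for n
    proof -
      have "measure M (space M) / \<delta> * norm (w n) \<le> measure M (space M) / \<delta> * D"
        using D \<delta>(1) by (intro mult_left_mono) auto
      then show ?thesis using gw_int[of "w n"] by linarith
    qed
    then obtain h r where h: "continuous_on S h" and r: "strict_mono (r :: nat \<Rightarrow> nat)"
      and lim: "\<And>e. e > 0 \<Longrightarrow> \<exists>N. \<forall>n x. n \<ge> N \<and> x \<in> S \<longrightarrow>
        cmod (K (\<lambda>y. g y * apply_bcontfun (w (r n)) y) x - h x) < e"
      by (rule K_compact[where u = "\<lambda>n y. g y * apply_bcontfun (w n) y", OF S(1) gi[OF w_sq]]) blast
    have "compact (h ` S)" using h S(1) by (rule compact_continuous_image)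
    then obtain D' where D': "\<And>x. x \<in> S \<Longrightarrow> cmod (h x) \<le> D'"
      using compact_imp_bounded[of "h ` S"] by (auto simp: bounded_iff)
    have "(\<lambda>x. - h (P x)) \<in> bcontfun"
    proof (rule bcontfun_normI)
      show "continuous_on UNIV (\<lambda>x. - h (P x))"
        using P_S by (intro continuous_intros continuous_on_compose2[OF h P_cont]) auto
      show "cmod (- h (P x)) \<le> D'" for x using D'[OF P_S] by simp
    qed
    then have l: "apply_bcontfun (Bcontfun (\<lambda>x. - h (P x))) x = - h (P x)" for x
      by (simp add: Bcontfun_inverse)
    have "(\<lambda>n. C (w (r n))) \<longlonglongrightarrow> Bcontfun (\<lambda>x. - h (P x))"
    proof (rule LIMSEQ_I)
      fix e :: real assume "e > 0"
      then obtain N where N: "\<And>n x. n \<ge> N \<Longrightarrow> x \<in> S \<Longrightarrow>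
          cmod (K (\<lambda>y. g y * apply_bcontfun (w (r n)) y) x - h x) < e / 2"
        using lim[of "e / 2"] by auto
      have "norm (C (w (r n)) - Bcontfun (\<lambda>x. - h (P x))) \<le> e / 2" if "n \<ge> N" for n
        using N[OF that P_S] by (intro norm_bound) (simp add: C l norm_minus_commute less_imp_le)
      then show "\<exists>N. \<forall>n\<ge>N. norm (C (w (r n)) - Bcontfun (\<lambda>x. - h (P x))) < e"
        using \<open>e > 0\<close> by (intro exI[of _ N]) force
    qed
    with r show "\<exists>r l. strict_mono r \<and> (\<lambda>n. C (w (r n))) \<longlonglongrightarrow> l" by blast
  qed
  have "w = 0" if "w = C w" for w
  proof -
    define u where "u y = g y * apply_bcontfun w y" for y
    have u: "u \<in> square_integrable M" using g_sq[OF w_sq] by (simp add: u_def[abs_def])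
    have w: "apply_bcontfun w x = - K u (P x)" for x
      using C[of w x] by (simp add: u_def[abs_def] flip: that)
    have "N u x - c * u x = 0" if "x \<in> \<Omega>" for x
    proof -
      have "N u x - c * u x = K u x + (complex_of_real (b x) - c) * u x"
        by (simp add: N_def algebra_simps)
      also have "(complex_of_real (b x) - c) * u x = apply_bcontfun w x"
        using nz[OF that] by (simp add: u_def g_def)
      finally show ?thesis by (simp add: w P_id that)
    qed
    then have "AE x in M. N u x - c * u x = 0" by (intro AE_I2) simp
    with not_ev u have "AE x in M. u x = 0" unfolding eigenvalue_iff by blast
    then have "K u x = K (\<lambda>y. 0) x" for x
      using u by (intro K_cong_AE) (auto simp: square_integrable_def)
    then have "K u x = 0" for x by (simp add: K_def)
    with w show "w = 0" by (intro bcontfun_eqI) simp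
  qed
  note C_props = C_lin C_compact this
  have C_surj: "surj (\<lambda>w. w - C w)" by (rule fredholm_alternative[OF C_props])
  obtain a where a: "a > 0" "\<And>w. a * norm w \<le> norm (w - C w)"
    by (rule compact_perturbation_bounded_below[OF C_props]) blast+
  show ?thesis
  proof (rule not_spectrumI)
    fix f assume f: "f \<in> square_integrable M"
    obtain w where w: "A (\<lambda>y. g y * f y) = w - C w" using C_surj by (meson surjD)
    \<comment> \<open>from \<open>w + K (g w) = K (g f)\<close> the solution is \<open>u = g (f - w)\<close>, and then \<open>K u = w\<close>\<close>
    define u where "u x = g x * f x - g x * apply_bcontfun w x" for x
    have u: "u \<in> square_integrable M"
      using square_integrable_minus[OF g_sq[OF f] g_sq[OF w_sq[of w]]] by (simp add: u_def[abs_def])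
    have "N u x - c * u x = f x" if "x \<in> \<Omega>" for x
    proof -
      have "K (\<lambda>y. g y * f y) x = apply_bcontfun w x + K (\<lambda>y. g y * apply_bcontfun w y) x"
        using arg_cong[OF w, of "\<lambda>w. apply_bcontfun w x"] by (simp add: A[OF g_sq[OF f]] C P_id that)
      then have "K u x = apply_bcontfun w x"
        using K_minus[OF gi[OF f] gi[OF w_sq[of w]]] by (simp add: u_def[abs_def])
      moreover have "N u x - c * u x = K u x + (complex_of_real (b x) - c) * u x"
        by (simp add: N_def algebra_simps)
      moreover have "(complex_of_real (b x) - c) * u x =
          ((complex_of_real (b x) - c) * g x) * (f x - apply_bcontfun w x)"
        unfolding u_def by (simp only: right_diff_distrib mult.assoc)
      then have "(complex_of_real (b x) - c) * u x = f x - apply_bcontfun w x"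
        by (simp only: bg[OF that] mult_1)
      ultimately show ?thesis by simp
    qed
    then have "AE x in M. N u x - c * u x = f x" by (intro AE_I2) simp
    with u show "\<exists>u\<in>square_integrable M. AE x in M. N u x - c * u x = f x" by blast
  next
    fix u assume u: "u \<in> square_integrable M"
    define f where "f x = N u x - c * u x" for x
    have f: "f \<in> square_integrable M" using square_integrable_shift[OF u] by (simp add: f_def[abs_def])
    define \<mu> where "\<mu> = measure M (space M)"
    \<comment> \<open>conversely \<open>w = K u\<close> solves \<open>w + K (g w) = K (g f)\<close>, so \<open>norm w\<close> is controlled by \<open>f\<close>\<close>
    define w where "w = A u"
    have u_eq: "u x = g x * f x - g x * apply_bcontfun w x" if "x \<in> \<Omega>" for x
    proof -
      have "(complex_of_real (b x) - c) * u x = f x - apply_bcontfun w x"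
        by (simp add: w_def A[OF u] P_id that f_def N_def algebra_simps)
      moreover have "u x = g x * ((complex_of_real (b x) - c) * u x)"
        using bg[OF that] by (metis mult.assoc mult.commute mult_1)
      ultimately show ?thesis by (simp only: right_diff_distrib)
    qed
    have "w - C w = A (\<lambda>y. g y * f y)"
    proof (rule bcontfun_eqI)
      fix x
      have "K (\<lambda>y. g y * f y - g y * apply_bcontfun w y) (P x) = K u (P x)"
        using u_eq u square_integrable_minus[OF g_sq[OF f] g_sq[OF w_sq[of w]]]
        by (intro K_cong_AE AE_I2) (auto simp: square_integrable_def)
      then have "K u (P x) + K (\<lambda>y. g y * apply_bcontfun w y) (P x) = K (\<lambda>y. g y * f y) (P x)"
        using K_minus[OF gi[OF f] gi[OF w_sq[of w]], of "P x"] by (simp add: diff_eq_eq)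
      moreover have "apply_bcontfun w x = K u (P x)" by (simp add: w_def A[OF u])
      ultimately show "apply_bcontfun (w - C w) x = apply_bcontfun (A (\<lambda>y. g y * f y)) x"
        by (simp only: minus_bcontfun.rep_eq C A[OF g_sq[OF f]] diff_minus_eq_add)
    qed
    then have "a * norm w \<le> B * (LINT y|M. cmod (g y * f y))"
      using a(2)[of w] A_norm[OF g_sq[OF f]] by simp
    also have "(LINT y|M. cmod (g y * f y)) \<le> (LINT y|M. 1 / \<delta> * cmod (f y))"
      using g_le gi[OF f] square_integrable_imp_integrable_cmod[OF f] unfolding norm_mult
      by (intro integral_mono mult_right_mono) (auto simp flip: norm_mult)
    finally have "norm w \<le> B / (a * \<delta>) * (LINT y|M. cmod (f y))"
      using a(1) B(1) \<delta>(1) by (simp add: field_simps)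
    then have "(norm w)\<^sup>2 \<le> (B / (a * \<delta>))\<^sup>2 * (LINT y|M. cmod (f y))\<^sup>2"
      by (metis norm_ge_zero power_mono power_mult_distrib)
    also have "\<dots> \<le> (B / (a * \<delta>))\<^sup>2 * (\<mu> * (LINT y|M. (cmod (f y))\<^sup>2))"
      unfolding \<mu>_def by (intro mult_left_mono integral_cmod_power2_le[OF f]) simp
    finally have w_le: "(norm w)\<^sup>2 \<le> (B / (a * \<delta>))\<^sup>2 * (\<mu> * (LINT y|M. (cmod (f y))\<^sup>2))" .
    have u_le: "(cmod (u x))\<^sup>2 \<le> 2 / \<delta>\<^sup>2 * (cmod (f x))\<^sup>2 + 2 / \<delta>\<^sup>2 * (norm w)\<^sup>2" if "x \<in> \<Omega>" for x
    proof -
      have "cmod (u x) = cmod (g x) * cmod (f x - apply_bcontfun w x)"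
        by (simp add: u_eq[OF that] norm_mult flip: right_diff_distrib)
      also have "\<dots> \<le> 1 / \<delta> * (cmod (f x) + norm w)"
        using g_le[OF that] \<delta>(1) norm_triangle_ineq4[of "f x" "apply_bcontfun w x"] norm_bounded[of w x]
        by (intro mult_mono) auto
      finally have "(cmod (u x))\<^sup>2 \<le> (1 / \<delta> * (cmod (f x) + norm w))\<^sup>2"
        by (simp add: power_mono)
      also have "\<dots> = 1 / \<delta>\<^sup>2 * (cmod (f x) + norm w)\<^sup>2" by (simp add: power_mult_distrib power_divide)
      also have "\<dots> \<le> 1 / \<delta>\<^sup>2 * (2 * (cmod (f x))\<^sup>2 + 2 * (norm w)\<^sup>2)"
        using sum_squares_bound[of "cmod (f x)" "norm w"]
        by (intro mult_left_mono) (auto simp: power2_sum)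
      finally show ?thesis by (simp add: distrib_left)
    qed
    have "(LINT x|M. (cmod (u x))\<^sup>2) \<le> (LINT x|M. 2 / \<delta>\<^sup>2 * (cmod (f x))\<^sup>2 + 2 / \<delta>\<^sup>2 * (norm w)\<^sup>2)"
      using u f u_le by (intro integral_mono) (auto simp: square_integrable_def)
    also have "\<dots> = 2 / \<delta>\<^sup>2 * (LINT x|M. (cmod (f x))\<^sup>2) + \<mu> * (2 / \<delta>\<^sup>2 * (norm w)\<^sup>2)"
      using f by (simp add: square_integrable_def \<mu>_def)
    also have "\<dots> \<le> 2 / \<delta>\<^sup>2 * (LINT x|M. (cmod (f x))\<^sup>2) +
        \<mu> * (2 / \<delta>\<^sup>2 * ((B / (a * \<delta>))\<^sup>2 * (\<mu> * (LINT y|M. (cmod (f y))\<^sup>2))))"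
      using w_le by (intro add_left_mono mult_left_mono) (auto simp: \<mu>_def)
    also have "\<dots> = (2 / \<delta>\<^sup>2 + \<mu> * (2 / \<delta>\<^sup>2 * ((B / (a * \<delta>))\<^sup>2 * \<mu>))) * (LINT x|M. (cmod (f x))\<^sup>2)"
      by (simp only: distrib_right mult.assoc)
    finally show "(LINT x|M. (cmod (u x))\<^sup>2) \<le>
        (2 / \<delta>\<^sup>2 + \<mu> * (2 / \<delta>\<^sup>2 * ((B / (a * \<delta>))\<^sup>2 * \<mu>))) * (LINT x|M. (cmod (N u x - c * u x))\<^sup>2)"
      by (simp only: f_def)
  qed
qed

text \<open>
  The indicator function \<open>u\<close> of a ball of measure \<open>a\<close> on which \<open>b\<close> differs from \<open>b x0\<close> by less than \<open>\<eta>\<close>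
  has squared norm \<open>a\<close>, while the squared norm of \<open>N u - c u\<close> is of order \<open>\<eta>\<^sup>2 a + a\<^sup>2\<close>. A bounded inverse
  would therefore bound \<open>1\<close> by a multiple of \<open>\<eta>\<^sup>2 + a\<close>.
\<close>

theorem multiplier_range_in_spectrum:
  assumes x0: "x0 \<in> closure \<Omega>"
  shows "complex_of_real (b x0) \<in> L2_spectrum M (L2_lift M N)"
proof (rule ccontr)
  define c where "c = complex_of_real (b x0)"
  assume "complex_of_real (b x0) \<notin> L2_spectrum M (L2_lift M N)"
  then obtain C' where C': "\<And>u. u \<in> square_integrable M \<Longrightarrow>
    sqrt (LINT x|M. (cmod (u x))\<^sup>2) \<le> C' * sqrt (LINT x|M. (cmod (N u x - c * u x))\<^sup>2)"
    unfolding c_def by (rule bounded_below_if_not_spectrum) blast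
  define C where "C = \<bar>C'\<bar> + 1"
  have C: "C > 0" by (simp add: C_def)
  have C_le: "(LINT x|M. (cmod (u x))\<^sup>2) \<le> C\<^sup>2 * (LINT x|M. (cmod (N u x - c * u x))\<^sup>2)"
    if "u \<in> square_integrable M" for u
  proof -
    have "sqrt (LINT x|M. (cmod (u x))\<^sup>2) \<le> C * sqrt (LINT x|M. (cmod (N u x - c * u x))\<^sup>2)"
      using C'[OF that] by (rule order_trans) (auto simp: C_def intro!: mult_right_mono)
    also have "\<dots> = sqrt (C\<^sup>2 * (LINT x|M. (cmod (N u x - c * u x))\<^sup>2))"
      using C by (simp add: real_sqrt_mult)
    finally show ?thesis by simp
  qed
  define \<eta> where "\<eta> = 1 / (2 * C)"
  have \<eta>: "\<eta> > 0" using C by (simp add: \<eta>_def)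
  obtain d where d: "d > 0" "\<And>x. x \<in> closure \<Omega> \<Longrightarrow> dist x x0 < d \<Longrightarrow> \<bar>b x - b x0\<bar> < \<eta>"
    using continuous_b x0 \<eta> unfolding continuous_on_iff dist_real_def by metis
  obtain x1 where x1: "x1 \<in> \<Omega>" "dist x1 x0 < d"
    using x0 d(1) by (auto simp: closure_approachable)
  have "open (\<Omega> \<inter> ball x0 d)" "x1 \<in> \<Omega> \<inter> ball x0 d"
    using open_\<Omega> x1 by (auto simp: dist_commute)
  then obtain \<rho> where \<rho>: "\<rho> > 0" "ball x1 \<rho> \<subseteq> \<Omega> \<inter> ball x0 d"
    by (meson open_contains_ball)
  obtain B where B: "B > 0" "\<And>x y. x \<in> closure \<Omega> \<Longrightarrow> y \<in> closure \<Omega> \<Longrightarrow> \<bar>k x y\<bar> \<le> B"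
    by (rule k_bounded[OF compact_closure_\<Omega>]) blast
  define \<mu> where "\<mu> = measure M (space M)"
  define v where "v = unit_ball_vol (real DIM('a))"
  have v: "v > 0" by (simp add: v_def)
  \<comment> \<open>the bound on the measure of the ball that makes the final contradiction work\<close>
  define t where "t = 1 / (4 * C\<^sup>2 * B\<^sup>2 * (\<mu> + 1))"
  have \<mu>: "\<mu> \<ge> 0" by (simp add: \<mu>_def)
  have t: "t > 0" using C B \<mu> by (simp add: t_def)
  define r where "r = min (min \<rho> 1) (t / v)"
  have r: "r > 0" "r \<le> 1" "r \<le> \<rho>" using \<rho>(1) t v by (auto simp: r_def)
  have "r \<le> t / v" by (simp add: r_def)
  then have r_le: "v * r \<le> t" using v by (simp add: pos_le_divide_eq mult.commute)
  define A where "A = ball x1 r"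
  have A: "A \<subseteq> \<Omega>" "A \<subseteq> ball x0 d" using \<rho>(2) r(3) by (auto simp: A_def)
  define a where "a = measure M A"
  have "a = measure lebesgue A"
    using A(1) by (simp add: a_def measure_restrict_space)
  also have "\<dots> = v * r ^ DIM('a)"
    using r(1) by (simp add: A_def v_def content_ball)
  finally have a_eq: "a = v * r ^ DIM('a)" .
  have a_pos: "a > 0" using a_eq v r(1) by simp
  have "r ^ DIM('a) \<le> r ^ 1" using r by (intro power_decreasing) (auto simp: Suc_le_eq)
  then have a_le: "a \<le> t" using a_eq v r_le by (smt (verit) mult_left_mono power_one_right)
  have A_meas [measurable]: "A \<in> sets M" using A(1) by (simp add: A_def sets_restrict_space_iff)
  define u where "u x = complex_of_real (indicator A x)" for x
  have u_meas [measurable]: "u \<in> borel_measurable M" unfolding u_def by measurable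
  have u: "u \<in> square_integrable M"
    by (rule square_integrable_if_bounded[where B = 1]) (auto simp: u_def indicator_def)
  have ui: "integrable M (indicator A :: 'a \<Rightarrow> real)"
    by (rule integrable_real_indicator[OF A_meas]) (simp add: emeasure_eq_measure)
  have int_A: "(LINT x|M. indicator A x) = a"
    using A(1) by (simp add: a_def Int_absorb2)
  have u_sq: "(cmod (u x))\<^sup>2 = indicator A x" and u_norm: "cmod (u x) = indicator A x" for x
    by (auto simp: u_def indicator_def)
  have Nu: "(cmod (N u x - c * u x))\<^sup>2 \<le> 2 * B\<^sup>2 * a\<^sup>2 + 2 * \<eta>\<^sup>2 * indicator A x" if x: "x \<in> \<Omega>" for x
  proof -
    have "cmod (K u x) \<le> B * (LINT y|M. cmod (u y))"
      using B(2) x closure_subset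
      by (intro K_bound square_integrable_imp_integrable_cmod[OF u]) blast
    then have 1: "cmod (K u x) \<le> B * a" by (simp only: u_norm int_A)
    have 2: "cmod (complex_of_real (b x - b x0) * u x) \<le> \<eta> * indicator A x"
    proof (cases "x \<in> A")
      case True
      then have "\<bar>b x - b x0\<bar> < \<eta>" using A x closure_subset by (intro d(2)) (auto simp: dist_commute)
      then show ?thesis using True by (simp add: u_def del: of_real_diff)
    qed (simp add: u_def)
    have eq: "N u x - c * u x = K u x + complex_of_real (b x - b x0) * u x"
      by (simp add: N_def c_def algebra_simps)
    have "cmod (N u x - c * u x) \<le> B * a + \<eta> * indicator A x"
      unfolding eq using 1 2 norm_triangle_ineq[of "K u x" "complex_of_real (b x - b x0) * u x"] by linarith
    then have "(cmod (N u x - c * u x))\<^sup>2 \<le> (B * a + \<eta> * indicator A x)\<^sup>2"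
      by (intro power_mono) auto
    also have "\<dots> \<le> 2 * (B * a)\<^sup>2 + 2 * (\<eta> * indicator A x)\<^sup>2"
      using sum_squares_bound[of "B * a" "\<eta> * indicator A x"] by (simp add: power2_sum)
    finally show ?thesis by (cases "x \<in> A") (simp_all add: power_mult_distrib)
  qed
  have "(LINT x|M. (cmod (N u x - c * u x))\<^sup>2) \<le> (LINT x|M. 2 * B\<^sup>2 * a\<^sup>2 + 2 * \<eta>\<^sup>2 * indicator A x)"
    using square_integrable_shift[OF u] ui Nu
    by (intro integral_mono) (auto simp: square_integrable_def)
  also have "\<dots> = \<mu> * (2 * B\<^sup>2 * a\<^sup>2) + 2 * \<eta>\<^sup>2 * a"
    using ui by (simp add: \<mu>_def flip: int_A)
  finally have "a \<le> C\<^sup>2 * (\<mu> * (2 * B\<^sup>2 * a\<^sup>2) + 2 * \<eta>\<^sup>2 * a)"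
    using C_le[OF u] by (simp only: u_sq int_A) (smt (verit) mult_left_mono zero_le_power2)
  also have "\<dots> = a * (2 * C\<^sup>2 * B\<^sup>2 * \<mu> * a + 1 / 2)"
    using C by (simp add: \<eta>_def power2_eq_square field_simps)
  finally have "1 \<le> 2 * C\<^sup>2 * B\<^sup>2 * \<mu> * a + 1 / 2"
    using a_pos by (metis mult.right_neutral mult_le_cancel_left_pos)
  moreover have "2 * C\<^sup>2 * B\<^sup>2 * \<mu> * a \<le> 2 * C\<^sup>2 * B\<^sup>2 * \<mu> * t"
    using a_le \<mu> by (intro mult_left_mono) auto
  moreover have "2 * C\<^sup>2 * B\<^sup>2 * \<mu> * t < 1 / 2"
  proof -
    define q where "q = 2 * C\<^sup>2 * B\<^sup>2 * t"
    have "q * (\<mu> + 1) = 1 / 2" using C B(1) \<mu> by (simp add: q_def t_def)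
    then have "q * \<mu> + q = 1 / 2" by (simp add: distrib_left)
    moreover have "q > 0" using C B(1) t by (simp add: q_def)
    moreover have "2 * C\<^sup>2 * B\<^sup>2 * \<mu> * t = q * \<mu>" by (simp add: q_def)
    ultimately show ?thesis by linarith
  qed
  ultimately show False by linarith
qed

lemma integrable_mult_cnj:
  assumes u: "u \<in> square_integrable M" and v: "v \<in> square_integrable M"
  shows "integrable M (\<lambda>x. u x * cnj (v x))"
proof -
  have [measurable]: "u \<in> borel_measurable M" "v \<in> borel_measurable M"
    using u v by (auto simp: square_integrable_def)
  have [measurable]: "cnj \<in> borel_measurable borel"
    by (intro borel_measurable_continuous_onI continuous_intros)
  show ?thesis
  proof (rule Bochner_Integration.integrable_bound)
    show "integrable M (\<lambda>x. (cmod (u x))\<^sup>2 + (cmod (v x))\<^sup>2)"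
      using u v by (simp add: square_integrable_def)
    have "cmod (u x) * cmod (v x) \<le> (cmod (u x))\<^sup>2 + (cmod (v x))\<^sup>2" for x
      using sum_squares_bound[of "cmod (u x)" "cmod (v x)"]
        mult_nonneg_nonneg[OF norm_ge_zero[of "u x"] norm_ge_zero[of "v x"]]
      unfolding mult.assoc by linarith
    then show "AE x in M. norm (u x * cnj (v x)) \<le> norm ((cmod (u x))\<^sup>2 + (cmod (v x))\<^sup>2)"
      by (intro AE_I2) (simp add: norm_mult)
  qed measurable
qed

lemma N_symmetric:
  assumes u: "u \<in> square_integrable M" and v: "v \<in> square_integrable M"
  shows "(LINT x|M. N u x * cnj (v x)) = (LINT x|M. u x * cnj (N v x))"
proof -
  have "(LINT x|M. N u x * cnj (v x)) =
      (LINT x|M. K u x * cnj (v x) + complex_of_real (b x) * u x * cnj (v x))"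
    by (simp add: N_def distrib_right)
  also have "\<dots> = (LINT x|M. K u x * cnj (v x)) + (LINT x|M. complex_of_real (b x) * u x * cnj (v x))"
    by (intro Bochner_Integration.integral_add integrable_mult_cnj K_square_integrable
        b_mult_square_integrable u v)
  also have "\<dots> = (LINT x|M. u x * cnj (K v x)) + (LINT x|M. u x * cnj (complex_of_real (b x) * v x))"
    unfolding K_symmetric[OF u v] by (simp add: ac_simps)
  also have "\<dots> = (LINT x|M. u x * cnj (K v x) + u x * cnj (complex_of_real (b x) * v x))"
    by (intro Bochner_Integration.integral_add[symmetric] integrable_mult_cnj K_square_integrable
        b_mult_square_integrable u v)
  also have "\<dots> = (LINT x|M. u x * cnj (N v x))"
    by (simp add: N_def distrib_left)
  finally show ?thesis .
qed

lemma eigenfunctions_inner: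
  assumes u: "u \<in> square_integrable M" and v: "v \<in> square_integrable M"
    and Nu: "AE x in M. N u x - c * u x = 0" and Nv: "AE x in M. N v x - d * v x = 0"
  shows "c * (LINT x|M. u x * cnj (v x)) = cnj d * (LINT x|M. u x * cnj (v x))"
proof -
  have meas: "(\<lambda>x. f x * cnj (g x)) \<in> borel_measurable M"
    if "f \<in> square_integrable M" "g \<in> square_integrable M" for f g
    using integrable_mult_cnj[OF that] by (rule borel_measurable_integrable)
  have "c * (LINT x|M. u x * cnj (v x)) = (LINT x|M. (c * u x) * cnj (v x))"
    by (simp add: mult.assoc)
  also have "\<dots> = (LINT x|M. N u x * cnj (v x))"
    using Nu by (intro integral_cong_AE meas square_integrable square_integrable_scale u v) auto
  also have "\<dots> = (LINT x|M. u x * cnj (N v x))" by (rule N_symmetric[OF u v])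
  also have "\<dots> = (LINT x|M. u x * cnj (d * v x))"
    using Nv by (intro integral_cong_AE meas square_integrable square_integrable_scale u v) auto
  also have "\<dots> = cnj d * (LINT x|M. u x * cnj (v x))"
    by (simp add: mult.left_commute)
  finally show ?thesis .
qed

lemma normalized_eigenfunction:
  assumes "L2_eigenvalue M (L2_lift M N) c"
  obtains u where "u \<in> square_integrable M" "(LINT x|M. (cmod (u x))\<^sup>2) = 1"
    "AE x in M. N u x - c * u x = 0"
proof -
  obtain u where u: "u \<in> square_integrable M" and nz: "\<not> (AE x in M. u x = 0)"
    and Nu: "AE x in M. N u x - c * u x = 0"
    using assms unfolding eigenvalue_iff by blast
  define s where "s = (LINT x|M. (cmod (u x))\<^sup>2)"
  have "s \<noteq> 0"
  proof
    assume "s = 0"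
    then have "AE x in M. (cmod (u x))\<^sup>2 = 0"
      using u unfolding s_def
      by (subst (asm) integral_nonneg_eq_0_iff_AE) (auto simp: square_integrable_def)
    with nz show False by simp
  qed
  moreover have "s \<ge> 0" by (simp add: s_def)
  ultimately have s: "s > 0" by simp
  define q where "q = complex_of_real (1 / sqrt s)"
  show ?thesis
  proof (rule that[of "\<lambda>x. q * u x"])
    show "(\<lambda>x. q * u x) \<in> square_integrable M" using u by (rule square_integrable_scale)
    have "(LINT x|M. (cmod (q * u x))\<^sup>2) = (cmod q)\<^sup>2 * s"
      by (simp add: norm_mult power_mult_distrib s_def)
    then show "(LINT x|M. (cmod (q * u x))\<^sup>2) = 1"
      using s by (simp add: q_def norm_divide power_divide)
    have "N (\<lambda>x. q * u x) x - c * (q * u x) = q * (N u x - c * u x)" for x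
      by (simp add: N_def K_scale algebra_simps)
    then show "AE x in M. N (\<lambda>x. q * u x) x - c * (q * u x) = 0"
      using Nu by simp
  qed
qed

lemma eigenvalue_real:
  assumes "L2_eigenvalue M (L2_lift M N) c"
  shows "cnj c = c"
proof -
  obtain u where u: "u \<in> square_integrable M" "(LINT x|M. (cmod (u x))\<^sup>2) = 1"
    "AE x in M. N u x - c * u x = 0"
    by (rule normalized_eigenfunction[OF assms])
  have "(LINT x|M. u x * cnj (u x)) = (LINT x|M. complex_of_real ((cmod (u x))\<^sup>2))"
    by (simp only: complex_norm_square)
  also have "\<dots> = 1" by (subst integral_complex_of_real) (simp add: u(2))
  finally have "(LINT x|M. u x * cnj (u x)) = 1" .
  with eigenfunctions_inner[OF u(1) u(1) u(3) u(3)] show ?thesis by simp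
qed

lemma eigenfunctions_dist:
  assumes u: "u \<in> square_integrable M" "(LINT x|M. (cmod (u x))\<^sup>2) = 1" "AE x in M. N u x - c * u x = 0"
    and v: "v \<in> square_integrable M" "(LINT x|M. (cmod (v x))\<^sup>2) = 1" "AE x in M. N v x - d * v x = 0"
    and d: "cnj d = d" and "c \<noteq> d"
  shows "(LINT x|M. (cmod (u x - v x))\<^sup>2) = 2"
proof -
  have "(c - d) * (LINT x|M. u x * cnj (v x)) = 0"
    using eigenfunctions_inner[OF u(1) v(1) u(3) v(3)] d by (simp add: left_diff_distrib)
  then have inner: "(LINT x|M. u x * cnj (v x)) = 0" using \<open>c \<noteq> d\<close> by simp
  define R where "R x = Re (u x * cnj (v x))" for x
  have R_int: "integrable M R"
    unfolding R_def by (intro integrable_Re integrable_mult_cnj u v)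
  have "(LINT x|M. R x) = Re (LINT x|M. u x * cnj (v x))"
    unfolding R_def by (intro integral_Re integrable_mult_cnj u v)
  then have R_0: "(LINT x|M. R x) = 0" by (simp add: inner)
  have "(cmod (u x - v x))\<^sup>2 = (cmod (u x))\<^sup>2 + (cmod (v x))\<^sup>2 - 2 * R x" for x
    unfolding cmod_power2 R_def by (simp add: power2_eq_square algebra_simps)
  then have "(LINT x|M. (cmod (u x - v x))\<^sup>2) =
      (LINT x|M. (cmod (u x))\<^sup>2 + (cmod (v x))\<^sup>2 - 2 * R x)"
    by simp
  also have "\<dots> = (LINT x|M. (cmod (u x))\<^sup>2) + (LINT x|M. (cmod (v x))\<^sup>2) - 2 * (LINT x|M. R x)"
    using u(1) v(1) R_int by (simp add: square_integrable_def)
  finally show ?thesis by (simp add: u(2) v(2) R_0)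
qed

text \<open>
  The point \<open>c\<close> itself need not be an eigenvalue, so the lemma excludes accumulation of eigenvalues
  at every point outside the range of \<open>b\<close>.
\<close>

lemma eigenvalues_isolated:
  assumes c: "c \<notin> complex_of_real ` b ` closure \<Omega>"
  shows "\<exists>e>0. \<forall>d. L2_eigenvalue M (L2_lift M N) d \<and> dist d c < e \<longrightarrow> d = c"
proof (rule ccontr)
  assume contra: "\<not> ?thesis"
  obtain \<delta> where \<delta>: "\<delta> > 0" "\<And>x. x \<in> closure \<Omega> \<Longrightarrow> \<delta> \<le> cmod (complex_of_real (b x) - c)"
    by (rule multiplier_gap[OF c]) blast
  have "\<exists>d. L2_eigenvalue M (L2_lift M N) d \<and> dist d c < min (\<delta> / 2) (inverse (real (Suc n))) \<and> d \<noteq> c" for n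
  proof -
    have "min (\<delta> / 2) (inverse (real (Suc n))) > 0" using \<delta>(1) by simp
    with contra show ?thesis by blast
  qed
  then have "\<forall>n. \<exists>d. L2_eigenvalue M (L2_lift M N) d \<and> dist d c < min (\<delta> / 2) (inverse (real (Suc n))) \<and> d \<noteq> c" ..
  from choice[OF this] obtain l where l: "\<And>n. L2_eigenvalue M (L2_lift M N) (l n)"
    "\<And>n. dist (l n) c < min (\<delta> / 2) (inverse (real (Suc n)))" "\<And>n. l n \<noteq> c" by blast
  have "\<exists>u. u \<in> square_integrable M \<and> (LINT x|M. (cmod (u x))\<^sup>2) = 1 \<and>
      (AE x in M. N u x - l n * u x = 0)" for n
    by (rule normalized_eigenfunction[OF l(1)[of n]]) blast
  then have "\<forall>n. \<exists>u. u \<in> square_integrable M \<and> (LINT x|M. (cmod (u x))\<^sup>2) = 1 \<and>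
      (AE x in M. N u x - l n * u x = 0)" ..
  from choice[OF this] obtain u where u: "\<And>n. u n \<in> square_integrable M"
    "\<And>n. (LINT x|M. (cmod (u n x))\<^sup>2) = 1" "\<And>n. AE x in M. N (u n) x - l n * u n x = 0" by blast
  define \<mu> where "\<mu> = measure M (space M)"
  have \<mu>: "\<mu> \<ge> 0" by (simp add: \<mu>_def)
  have "(LINT x|M. cmod (u n x)) \<le> sqrt \<mu>" for n
    using integral_cmod_power2_le[OF u(1)[of n]] by (intro real_le_rsqrt) (simp add: u(2) \<mu>_def)
  then obtain h r where h: "continuous_on (closure \<Omega>) h" and r: "strict_mono (r :: nat \<Rightarrow> nat)"
    and lim: "\<And>e. e > 0 \<Longrightarrow> \<exists>N. \<forall>n x. n \<ge> N \<and> x \<in> closure \<Omega> \<longrightarrow> cmod (K (u (r n)) x - h x) < e"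
    by (rule K_compact[where u = u, OF compact_closure_\<Omega> square_integrable_imp_integrable_cmod[OF u(1)]]) blast
  have "compact (h ` closure \<Omega>)" using h compact_closure_\<Omega> by (rule compact_continuous_image)
  then have "bounded (h ` closure \<Omega>)" by (rule compact_imp_bounded)
  then obtain D where D: "D > 0" "\<And>x. x \<in> closure \<Omega> \<Longrightarrow> cmod (h x) \<le> D"
    by (auto simp: bounded_pos)
  have "(\<lambda>n. dist (l n) c) \<longlonglongrightarrow> 0"
    using l(2) by (intro Lim_null_comparison[OF always_eventually LIMSEQ_inverse_real_of_nat] allI)
      (simp add: less_imp_le)
  from LIMSEQ_subseq_LIMSEQ[OF this r] have l_lim: "(\<lambda>n. dist (l (r n)) c) \<longlonglongrightarrow> 0" by (simp add: o_def)
  \<comment> \<open>functions that differ by at most \<open>2 \<eta>\<close> then have squared \<open>L\<^sup>2\<close> distance at most \<open>1\<close>\<close>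
  define \<eta> where "\<eta> = 1 / (2 * (\<mu> + 1))"
  have \<eta>: "\<eta> > 0" "\<eta> * (\<mu> + 1) = 1 / 2" using \<mu> by (simp_all add: \<eta>_def)
  \<comment> \<open>the tolerances for \<open>K u\<^sub>n\<close> and for the eigenvalues contribute \<open>\<eta> / 2\<close> each
    to the distance between \<open>u\<^sub>n\<close> and \<open>h / (c - b)\<close>\<close>
  define e1 where "e1 = \<eta> * \<delta> / 4"
  define e2 where "e2 = \<eta> * \<delta>\<^sup>2 / (4 * D)"
  have e: "e1 > 0" "e2 > 0" using \<eta>(1) \<delta>(1) D(1) by (simp_all add: e1_def e2_def)
  obtain N1 where N1: "\<And>n x. n \<ge> N1 \<Longrightarrow> x \<in> closure \<Omega> \<Longrightarrow> cmod (K (u (r n)) x - h x) < e1"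
    using lim[OF e(1)] by blast
  obtain N2 where N2: "\<And>n. n \<ge> N2 \<Longrightarrow> dist (l (r n)) c < e2"
    using order_tendstoD(2)[OF l_lim e(2)] by (auto simp: eventually_sequentially)
  define n where "n = max N1 N2"
  \<comment> \<open>the eigenvalues \<open>l n\<close> may repeat; as they tend to \<open>c\<close> without attaining it, a later one is different\<close>
  obtain N3 where N3: "\<And>m. m \<ge> N3 \<Longrightarrow> dist (l (r m)) c < dist (l (r n)) c"
    using order_tendstoD(2)[OF l_lim, of "dist (l (r n)) c"] l(3) by (auto simp: eventually_sequentially)
  define m where "m = max n N3"
  have "m \<ge> N3" by (simp add: m_def)
  from N3[OF this] have neq: "l (r n) \<noteq> l (r m)" by auto
  have close: "AE x in M. cmod (u (r j) x - h x / (c - complex_of_real (b x))) \<le> \<eta>" if j: "j \<ge> n" for j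
    using u(3)[of "r j"] AE_space
  proof eventually_elim
    case (elim x)
    then have x: "x \<in> closure \<Omega>" using closure_subset by auto
    define p where "p = l (r j) - complex_of_real (b x)"
    define q where "q = c - complex_of_real (b x)"
    have q_ge: "cmod q \<ge> \<delta>" using \<delta>(2)[OF x] by (simp add: q_def norm_minus_commute)
    have pq: "cmod (p - q) < \<delta> / 2" "cmod (p - q) < e2"
      using l(2)[of "r j"] N2[of j] j by (auto simp: p_def q_def n_def dist_norm)
    have p_ge: "cmod p \<ge> \<delta> / 2"
      using pq(1) q_ge norm_triangle_ineq2[of q "q - p"] by (simp add: norm_minus_commute)
    have nz: "p \<noteq> 0" "q \<noteq> 0" using p_ge q_ge \<delta>(1) by auto
    have "K (u (r j)) x = p * u (r j) x"
      using elim(1) by (simp add: N_def p_def algebra_simps)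
    then have "u (r j) x - h x / q = (K (u (r j)) x - h x) / p - h x * (p - q) / (p * q)"
      using nz by (simp add: field_simps)
    then have 1: "cmod (u (r j) x - h x / q) \<le>
        cmod ((K (u (r j)) x - h x) / p) + cmod (h x * (p - q) / (p * q))"
      by (simp only: norm_triangle_ineq4)
    have 2: "cmod ((K (u (r j)) x - h x) / p) \<le> e1 / (\<delta> / 2)"
      unfolding norm_divide using N1[of j x] j x p_ge \<delta>(1) e(1)
      by (intro frac_le) (auto simp: n_def less_imp_le)
    have 3: "cmod (h x * (p - q) / (p * q)) \<le> (D * e2) / (\<delta> / 2 * \<delta>)"
      unfolding norm_divide norm_mult using D x pq(2) p_ge q_ge \<delta>(1) e(2)
      by (intro frac_le mult_mono) (auto simp: less_imp_le)
    have "e1 / (\<delta> / 2) + (D * e2) / (\<delta> / 2 * \<delta>) = \<eta>"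
      using \<delta>(1) D(1) by (simp add: e1_def e2_def power2_eq_square)
    with 1 2 3 have "cmod (u (r j) x - h x / q) \<le> \<eta>" by linarith
    then show ?case by (simp add: q_def)
  qed
  have "n \<le> m" by (simp add: m_def)
  have "AE x in M. cmod (u (r n) x - u (r m) x) \<le> 2 * \<eta>"
    using close[OF order_refl] close[OF \<open>n \<le> m\<close>]
  proof eventually_elim
    case (elim x)
    then show ?case
      using norm_triangle_ineq4[of "u (r n) x - h x / (c - complex_of_real (b x))"
          "u (r m) x - h x / (c - complex_of_real (b x))"] by simp
  qed
  then have "AE x in M. (cmod (u (r n) x - u (r m) x))\<^sup>2 \<le> (2 * \<eta>)\<^sup>2"
    by eventually_elim (intro power_mono norm_ge_zero)
  then have "(LINT x|M. (cmod (u (r n) x - u (r m) x))\<^sup>2) \<le> (LINT x|M. (2 * \<eta>)\<^sup>2)"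
    using square_integrable_minus[OF u(1) u(1)]
    by (intro integral_mono_AE) (auto simp: square_integrable_def)
  moreover have "(LINT x|M. (cmod (u (r n) x - u (r m) x))\<^sup>2) = 2"
    by (rule eigenfunctions_dist[OF u(1) u(2) u(3) u(1) u(2) u(3) eigenvalue_real[OF l(1)] neq])
  ultimately have "2 \<le> \<mu> * (2 * \<eta>)\<^sup>2" by (simp add: \<mu>_def)
  also have "\<dots> \<le> (\<mu> + 1) * (2 * \<eta>)\<^sup>2" by (intro mult_right_mono) auto
  also have "\<dots> = 4 * \<eta> * (\<eta> * (\<mu> + 1))" by (simp add: power2_eq_square)
  also have "\<dots> = 2 * \<eta>" by (simp add: \<eta>(2))
  also have "\<dots> \<le> 1" using \<mu> by (simp add: \<eta>_def)
  finally show False by simp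
qed

lemma eigenvalue_if_spectrum:
  assumes "c \<in> L2_spectrum M (L2_lift M N)" "c \<notin> complex_of_real ` b ` closure \<Omega>"
  shows "L2_eigenvalue M (L2_lift M N) c"
  using not_spectrum_if_not_eigenvalue assms by blast

lemma spectrum_not_islimpt:
  assumes c: "c \<notin> complex_of_real ` b ` closure \<Omega>"
  shows "\<not> c islimpt L2_spectrum M (L2_lift M N)"
proof -
  obtain \<delta> where \<delta>: "\<delta> > 0" "\<And>x. x \<in> closure \<Omega> \<Longrightarrow> \<delta> \<le> cmod (complex_of_real (b x) - c)"
    by (rule multiplier_gap[OF c]) blast
  obtain e where e: "e > 0" "\<And>d. L2_eigenvalue M (L2_lift M N) d \<Longrightarrow> dist d c < e \<Longrightarrow> d = c"
    using eigenvalues_isolated[OF c] by blast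
  have "d = c" if d: "d \<in> L2_spectrum M (L2_lift M N)" "dist d c < min e \<delta>" for d
  proof (rule e(2))
    have "d \<notin> complex_of_real ` b ` closure \<Omega>"
      using \<delta>(2) d(2) by (force simp: dist_norm)
    with d(1) show "L2_eigenvalue M (L2_lift M N) d" by (rule eigenvalue_if_spectrum)
  qed (use d in simp)
  moreover have "min e \<delta> > 0" using e \<delta> by simp
  ultimately show ?thesis unfolding islimpt_approachable by blast
qed

text \<open>
  The eigenvalue \<open>c0\<close> is needed only to have an enumeration by all natural numbers; the sequence may
  repeat values.
\<close>

theorem spectrum_decomposition:
  assumes c0: "L2_eigenvalue M (L2_lift M N) c0" "c0 \<notin> complex_of_real ` b ` closure \<Omega>"
  obtains \<beta> :: "nat \<Rightarrow> complex" where "\<And>n. L2_isolated_eigenvalue M (L2_lift M N) (\<beta> n)"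
    "L2_spectrum M (L2_lift M N) = complex_of_real ` b ` closure \<Omega> \<union> range \<beta>"
proof -
  let ?\<sigma> = "L2_spectrum M (L2_lift M N)" and ?B = "complex_of_real ` b ` closure \<Omega>"
  have "compact ?B"
    using continuous_b compact_closure_\<Omega>
    by (intro compact_continuous_image continuous_intros continuous_on_id) auto
  then have op: "open (- ?B)" using compact_imp_closed by blast
  have "?\<sigma> sparse_in - ?B"
    unfolding sparse_in_def using op spectrum_not_islimpt by blast
  then have countable: "countable (- ?B \<inter> ?\<sigma>)" by (intro sparse_imp_countable op)
  have "c0 \<in> - ?B \<inter> ?\<sigma>" using c0 eigenvalue_in_spectrum by blast
  then have nonempty: "- ?B \<inter> ?\<sigma> \<noteq> {}" by blast
  define \<beta> where "\<beta> = from_nat_into (- ?B \<inter> ?\<sigma>)"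
  have \<beta>: "range \<beta> = - ?B \<inter> ?\<sigma>"
    unfolding \<beta>_def by (rule range_from_nat_into[OF nonempty countable])
  show ?thesis
  proof (rule that)
    show "L2_isolated_eigenvalue M (L2_lift M N) (\<beta> n)" for n
    proof -
      have "\<beta> n \<in> ?\<sigma>" "\<beta> n \<notin> ?B" using \<beta> by blast+
      then show ?thesis
        unfolding L2_isolated_eigenvalue_def isolated_in_islimpt_iff
        using eigenvalue_if_spectrum spectrum_not_islimpt by blast
    qed
    show "?\<sigma> = ?B \<union> range \<beta>"
      using multiplier_range_in_spectrum unfolding \<beta> by blast
  qed
qed

end

section \<open>The nonlocal operator\<close>

lemma integral_pos_if_continuous:
  fixes f :: "'a::euclidean_space \<Rightarrow> real"
  assumes S: "open S" and f: "continuous_on S f" "integrable (lebesgue_on S) f"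
    "\<And>x. x \<in> S \<Longrightarrow> f x \<ge> 0" and x: "x \<in> S" "f x > 0"
  shows "(LINT x|lebesgue_on S. f x) > 0"
proof -
  have [simp]: "S \<in> sets lebesgue" using S by (simp add: borel_open)
  have "(LINT x|lebesgue_on S. f x) \<noteq> 0"
  proof
    assume "(LINT x|lebesgue_on S. f x) = 0"
    then have "AE x in lebesgue_on S. f x = 0"
      using f by (subst (asm) integral_nonneg_eq_0_iff_AE) (auto intro!: AE_I2)
    then have "AE x in lebesgue. x \<in> S \<longrightarrow> f x = 0"
      by (simp add: AE_restrict_space_iff)
    then have "AE x in lebesgue. x \<notin> S \<inter> f -` {0<..}"
      by eventually_elim auto
    moreover have op: "open (S \<inter> f -` {0<..})"
      using f(1) S open_greaterThan by (rule continuous_open_preimage)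
    ultimately have "negligible (S \<inter> f -` {0<..})"
      using borel_open by (subst negligible_iff_null_sets) (auto simp: AE_iff_null_sets)
    with op have "S \<inter> f -` {0<..} = {}" using open_not_negligible by blast
    with x show False by auto
  qed
  moreover have "(LINT x|lebesgue_on S. f x) \<ge> 0"
    using f by (intro integral_nonneg_AE AE_I2) auto
  ultimately show ?thesis by simp
qed

lemma C_norm_pos:
  fixes J :: "real ^ 'n \<Rightarrow> real"
  assumes J: "continuous_on UNIV J" "\<And>z. J z \<ge> 0" "J 0 > 0"
    "integrable lebesgue (\<lambda>z. J z * (norm z)\<^sup>2)"
  shows "C_norm J > 0"
proof -
  obtain r where r: "r > 0" "\<And>z. dist z 0 < r \<Longrightarrow> dist (J z) (J 0) < J 0"
    using J(1,3) unfolding continuous_on_iff by (metis UNIV_I)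
  obtain z :: "real ^ 'n" where z: "norm z = r / 2"
    using vector_choose_size[of "r / 2"] r(1) by auto
  then have "J z > 0" using r(1) r(2)[of z] by (simp add: dist_real_def)
  moreover have "norm z > 0" unfolding z using r(1) by simp
  ultimately have "J z * (norm z)\<^sup>2 > 0" by (intro mult_pos_pos zero_less_power)
  then have "(LINT z|lebesgue_on UNIV. J z * (norm z)\<^sup>2) > 0"
    using J by (intro integral_pos_if_continuous[where x = z] continuous_intros)
      (auto simp: lebesgue_on_UNIV_eq)
  then show ?thesis by (simp add: C_norm_def lebesgue_on_UNIV_eq)
qed

theorem theorem2p1:
  fixes \<Omega> :: "(real ^ 'n) set" and J :: "real ^ 'n \<Rightarrow> real" and \<epsilon> m :: real
  assumes "open \<Omega>" and "bounded \<Omega>" and "\<Omega> \<noteq> {}"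
    and "continuous_on UNIV J"
    and "\<And>z. J z \<ge> 0" and "J 0 > 0"
    and "\<And>z. J z = J (- z)"
    and "(J \<longlongrightarrow> 0) at_infinity"
    and "integrable lebesgue (\<lambda>z. J z * (norm z)\<^sup>2)"
    and "integrable lebesgue J" and "(LINT z|lebesgue. J z) = 1"
    and "\<epsilon> > 0" and "0 \<le> m" and "m \<le> 2"
  shows "\<exists>\<beta> :: nat \<Rightarrow> complex.
    (\<forall>k. L2_isolated_eigenvalue (lebesgue_on \<Omega>) (L_eps \<Omega> J m \<epsilon>) (\<beta> k)) \<and>
    L2_spectrum (lebesgue_on \<Omega>) (L_eps \<Omega> J m \<epsilon>) =
      complex_of_real ` (b_eps \<Omega> J m \<epsilon> ` closure \<Omega>) \<union> range \<beta>"
proof -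
  define k where "k x y = J_eps J m \<epsilon> (x - y)" for x y
  define b where "b = b_eps \<Omega> J m \<epsilon>"
  define w where "w = C_norm J / \<epsilon> powr (m + real CARD('n))"
  have k_eq: "k x y = w * J ((x - y) /\<^sub>R \<epsilon>)" for x y by (simp add: k_def J_eps_def w_def)
  have w: "w > 0" using C_norm_pos[of J] assms by (simp add: w_def)
  interpret continuous_kernel \<Omega> k
  proof
    show "continuous_on UNIV (\<lambda>p. k (fst p) (snd p))"
      unfolding k_eq by (intro continuous_intros continuous_on_compose2[OF assms(4)]) auto
    show "k x y = k y x" for x y
      using assms(7)[of "(x - y) /\<^sub>R \<epsilon>"] by (simp add: k_eq flip: scaleR_minus_right)
  qed (use assms in auto)
  have one: "(\<lambda>_. 1) \<in> square_integrable M"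
    by (intro continuous_imp_square_integrable continuous_intros)
  \<comment> \<open>by the definition of \<open>b\<close>, the operator annihilates constants\<close>
  have b_K: "complex_of_real (b x) = - K (\<lambda>_. 1) x" for x
    unfolding b_def b_eps_def K_def k_def by (simp flip: integral_complex_of_real)
  have "continuous_on (closure \<Omega>) (\<lambda>x. - Re (K (\<lambda>_. 1) x))"
    by (intro continuous_intros continuous_on_K square_integrable_imp_integrable_cmod[OF one])
  moreover have "b x = - Re (K (\<lambda>_. 1) x)" for x
    using arg_cong[OF b_K[of x], of Re] by simp
  ultimately interpret kernel_plus_multiplier \<Omega> k b
    by unfold_locales (simp cong: continuous_on_cong)
  have "nonlocal_fun \<Omega> J m \<epsilon> = N"
    unfolding fun_eq_iff nonlocal_fun_def N_def K_def by (simp add: k_def b_def)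
  then have L: "L_eps \<Omega> J m \<epsilon> = L2_lift M N" by (simp add: L_eps_def)
  \<comment> \<open>every point of the closure has points of \<open>\<Omega>\<close> within the range where \<open>J\<close> is positive\<close>
  have "b x < 0" if x: "x \<in> closure \<Omega>" for x
  proof -
    obtain r where r: "r > 0" "\<And>z. dist z 0 < r \<Longrightarrow> dist (J z) (J 0) < J 0"
      using assms(4,6) unfolding continuous_on_iff by (metis UNIV_I)
    obtain y where y: "y \<in> \<Omega>" "dist y x < \<epsilon> * r"
      using x r(1) assms(12) unfolding closure_approachable by (meson mult_pos_pos)
    have "norm ((x - y) /\<^sub>R \<epsilon>) = norm (x - y) / \<epsilon>"
      using assms(12) by (simp only: norm_scaleR) (simp add: divide_inverse mult.commute)
    also have "\<dots> < r"
      using y(2) assms(12) by (simp add: dist_norm norm_minus_commute pos_divide_less_eq mult.commute)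
    finally have "norm ((x - y) /\<^sub>R \<epsilon>) < r" .
    then have "J ((x - y) /\<^sub>R \<epsilon>) > 0" using r(2)[of "(x - y) /\<^sub>R \<epsilon>"] by (simp add: dist_real_def)
    then have "k x y > 0" using w by (simp add: k_eq)
    moreover have "k x y \<ge> 0" for y using w assms(5) by (simp add: k_eq)
    moreover have "integrable M (k x)"
      using integrable_Re[OF integrable_k_mult[OF square_integrable_imp_integrable_cmod[OF one], of x]]
      by simp
    ultimately have "(LINT y|M. k x y) > 0"
      using assms(1) y(1) by (intro integral_pos_if_continuous[where x = y] k_compose continuous_intros)
    then show ?thesis by (simp add: b_def b_eps_def k_def)
  qed
  then have zero: "0 \<notin> complex_of_real ` b ` closure \<Omega>" by force
  have "\<not> (AE x in M. (1::complex) = 0)"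
  proof
    assume "AE x in M. (1::complex) = 0"
    then have "AE x in lebesgue. x \<notin> \<Omega>" by (simp add: AE_restrict_space_iff)
    then have "negligible \<Omega>"
      by (subst negligible_iff_null_sets) (simp add: AE_iff_null_sets)
    with assms(1,3) show False using open_not_negligible by blast
  qed
  moreover have "AE x in M. N (\<lambda>_. 1) x - 0 * 1 = 0" by (simp add: N_def b_K)
  ultimately have "L2_eigenvalue M (L2_lift M N) 0"
    unfolding eigenvalue_iff using one by (intro bexI[of _ "\<lambda>_. 1"] conjI)
  from spectrum_decomposition[OF this zero] show ?thesis
    unfolding L b_def by metis
qed

end
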